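(* Let $p$ be a prime and let $G$ be a finite non-cyclic $p$-group with $|G|\ge p^3$ and with an abelian maximal subgroup $A$. Then $|G|$ divides $|\mathrm{Aut}(G)|$.
   Context: $\mathrm{Aut}(G)$ denotes the automorphism group of $G$. *)

theory Defs
  imports "HOL-Algebra.Algebra"
begin

definition finite_p_group :: "nat \<Rightarrow> ('a, 'b) monoid_scheme \<Rightarrow> bool"
  where "finite_p_group p G \<longleftrightarrow> group G \<and> finite (carrier G) \<and> (\<exists>n. order G = p ^ n)"

definition maximal_subgroup :: "'a set \<Rightarrow> ('a, 'b) monoid_scheme \<Rightarrow> bool"
  where "maximal_subgroup M G \<longleftrightarrow>
    subgroup M G \<and> M \<noteq> carrier G \<and>
    (\<forall>H. subgroup H G \<longrightarrow> M \<subseteq> H \<longrightarrow> H = M \<or> H = carrier G)"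

end

theory Submission
  imports Defs
begin

text \<open>Choose \<open>g\<close> outside \<open>A\<close> with \<open>g\<^sup>p \<in> A\<close>. Let \<open>N(a) = (a g)\<^sup>p g\<^sup>-\<^sup>p\<close> be the norm map of the action of
  \<open>g\<close> on \<open>A\<close>, \<open>C = N(A)\<close> its image and \<open>D = [A, g]\<close>. An automorphism \<open>\<phi>\<close> of \<open>A\<close> that commutes with
  the action of \<open>g\<close> and moves \<open>g\<^sup>p\<close> inside \<open>g\<^sup>p C\<close> extends to \<open>G\<close> in exactly \<open>|ker N|\<close> ways that are
  trivial on \<open>G/A\<close>; since \<open>|G| = p |C| |ker N|\<close>, it suffices to find a group of such \<open>\<phi>\<close> whose order
  is divisible by \<open>p |C|\<close>.

  The maps \<open>x \<mapsto> x \<psi>(x)\<close> with \<open>\<psi> : A/D \<rightarrow> C\<close> form such a group. As \<open>C\<close> is an image of \<open>A/D\<close>, its order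
  is divisible by \<open>|C|\<close>, and by \<open>p |C|\<close> when \<open>A/D\<close> is not cyclic and \<open>C \<noteq> 1\<close>. If \<open>D\<close> is not contained
  in \<open>C\<close>, conjugation by \<open>g\<close> supplies the missing factor \<open>p\<close>. If \<open>D \<subseteq> C = 1\<close>, then \<open>A\<close> is elementary
  abelian and central, and transvections do.

  In the remaining case \<open>A = \<langle>a\<rangle> D\<close> and \<open>D \<subseteq> C\<close>, the group \<open>D\<close> is central of order at most \<open>p\<close>, and
  \<open>G\<close> has another abelian maximal subgroup, with \<open>a\<close> in the role of \<open>g\<close>, to which the previous cases
  apply.\<close>

section \<open>Homomorphisms between abelian \<open>p\<close>-groups\<close>

lemma (in group_hom) card_fibre:
  assumes "y \<in> carrier G"
  shows "card {x \<in> carrier G. h x = h y} = card (kernel G H h)"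
proof -
  have "bij_betw (\<lambda>x. x \<otimes> y) (kernel G H h) {x \<in> carrier G. h x = h y}"
  proof (rule bij_betw_byWitness[where f' = "\<lambda>x. x \<otimes> inv y"])
  qed (use assms in \<open>auto simp: kernel_def G.m_assoc\<close>)
  then show ?thesis
    by (simp add: bij_betw_same_card)
qed

lemma card_fibred:
  assumes "finite A" and "\<And>y. y \<in> f ` A \<Longrightarrow> card {x \<in> A. f x = y} = k"
  shows "card A = card (f ` A) * k"
proof -
  have "card A = (\<Sum>y \<in> f ` A. card {x \<in> A. f x = y})"
    using sum.image_gen[OF assms(1), of "\<lambda>_. 1::nat" f] by simp
  then show ?thesis
    using assms(2) by simp
qed

lemma (in group_hom) card_kernel_image:
  assumes "finite (carrier G)"
  shows "card (carrier G) = card (h ` carrier G) * card (kernel G H h)"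
  by (rule card_fibred[OF assms]) (auto simp: card_fibre)

lemma (in group) int_pow_nat_pow:
  assumes "x \<in> carrier G"
  shows "(x [^] (i::int)) [^] (n::nat) = x [^] (i * int n)"
    and "(x [^] n) [^] i = x [^] (int n * i)"
  using int_pow_pow[OF assms] by (metis int_pow_int)+

text \<open>By Bezout, the power with exponent \<open>gcd i j\<close> is a product of powers of
  \<open>x [^] i\<close> and \<open>x [^] j\<close>.\<close>

lemma (in group) int_pow_gcd_mem:
  assumes "subgroup D G" "x \<in> carrier G" "x [^] (i::int) \<in> D" "x [^] (j::int) \<in> D"
  shows "x [^] (gcd i j) \<in> D"
proof -
  obtain u v where "u * i + v * j = gcd i j"
    using bezout_int by blast
  then have "x [^] (gcd i j) = (x [^] i) [^] u \<otimes> (x [^] j) [^] v"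
    using assms(2) by (metis int_pow_mult int_pow_pow mult.commute)
  then show ?thesis
    using assms by (simp add: subgroup_int_pow_closed subgroup.m_closed)
qed

text \<open>Otherwise \<open>i\<close> and \<open>p\<close> are coprime, and the gcd argument puts
  \<open>x\<close> itself into \<open>D\<close>.\<close>

lemma (in group) prime_dvd_of_int_pow_mem:
  assumes "Factorial_Ring.prime p" "subgroup D G" "x \<in> carrier G" "x \<notin> D" "x [^] p \<in> D"
    and "x [^] (i::int) \<in> D"
  shows "int p dvd i"
proof (rule ccontr)
  assume "\<not> int p dvd i"
  then have "gcd i (int p) = 1"
    using assms(1) by (metis coprime_imp_gcd_eq_1 coprime_commute prime_imp_coprime prime_nat_int_transfer)
  then show False
    using int_pow_gcd_mem[OF assms(2,3), of i "int p"] assms by (simp add: int_pow_int)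
qed

text \<open>Repeated \<open>p\<close>-th powers of \<open>x\<close> eventually enter
  \<open>D\<close>; the last one outside has its \<open>p\<close>-th power inside. This is the
  source of elements of order \<open>p\<close> relative to a subgroup.\<close>

lemma (in group) exists_last_power_notin:
  assumes "x \<in> carrier G" "x \<notin> D" "x [^] (p ^ n :: nat) \<in> D"
  shows "\<exists>k. x [^] (p ^ k :: nat) \<notin> D \<and> (x [^] (p ^ k :: nat)) [^] p \<in> D"
  using assms(3)
proof (induction n)
  case 0
  then show ?case using assms by simp
next
  case (Suc n)
  show ?case
  proof (cases "x [^] (p ^ n :: nat) \<in> D")
    case False
    moreover have "(x [^] (p ^ n)) [^] p = x [^] (p ^ Suc n)"
      using assms(1) by (simp add: nat_pow_pow mult.commute)
    ultimately show ?thesis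
      using Suc.prems by metis
  qed (rule Suc.IH)
qed

section \<open>Adjoining one element, and complements of a cyclic subgroup\<close>

lemma (in comm_group) subgroup_adjoin:
  assumes "subgroup K G" "x \<in> carrier G"
  shows "subgroup {x [^] (i::int) \<otimes> k | i k. k \<in> K} G"
proof -
  interpret K: subgroup K G by fact
  show ?thesis
  proof (rule subgroupI)
    show "{x [^] (i::int) \<otimes> k | i k. k \<in> K} \<noteq> {}"
      using K.one_closed by blast
  next
    fix a assume "a \<in> {x [^] (i::int) \<otimes> k | i k. k \<in> K}"
    then obtain i k where "a = x [^] (i::int) \<otimes> k" "k \<in> K" by auto
    then have "inv a = x [^] (- i) \<otimes> inv k" "inv k \<in> K"
      using assms by (auto simp: int_pow_neg inv_mult)
    then show "inv a \<in> {x [^] (i::int) \<otimes> k | i k. k \<in> K}" by blast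
  next
    fix a b assume "a \<in> {x [^] (i::int) \<otimes> k | i k. k \<in> K}" "b \<in> {x [^] (i::int) \<otimes> k | i k. k \<in> K}"
    then obtain i k j l where "a = x [^] (i::int) \<otimes> k" "k \<in> K" "b = x [^] (j::int) \<otimes> l" "l \<in> K" by auto
    then have "a \<otimes> b = x [^] (i + j) \<otimes> (k \<otimes> l)" "k \<otimes> l \<in> K"
      using assms by (auto simp: int_pow_mult m_ac)
    then show "a \<otimes> b \<in> {x [^] (i::int) \<otimes> k | i k. k \<in> K}" by blast
  qed (use assms in auto)
qed

lemma (in comm_group) adjoin_incl:
  assumes "subgroup K G" "x \<in> carrier G"
  shows "K \<subseteq> {x [^] (i::int) \<otimes> k | i k. k \<in> K}" "x \<in> {x [^] (i::int) \<otimes> k | i k. k \<in> K}"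
proof -
  interpret K: subgroup K G by fact
  have "k = x [^] (0::int) \<otimes> k" if "k \<in> K" for k
    using that by simp
  then show "K \<subseteq> {x [^] (i::int) \<otimes> k | i k. k \<in> K}" by blast
  have "x = x [^] (1::int) \<otimes> \<one>" using assms by simp
  then show "x \<in> {x [^] (i::int) \<otimes> k | i k. k \<in> K}" using K.one_closed by blast
qed

text \<open>A subgroup \<open>K\<close> maximal subject to meeting the powers of \<open>x\<close> only inside \<open>D\<close> is a
  complement of \<open>x\<close> modulo \<open>D\<close>.\<close>
lemma (in comm_group) complement_mod:
  assumes "finite (carrier G)" "Factorial_Ring.prime p" "order G = p ^ n"
    and D: "subgroup D G" and x: "x \<in> carrier G"
    and exp: "\<And>y. y \<in> carrier G \<Longrightarrow> y [^] (p ^ e :: nat) \<in> D"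
    and dvd: "\<And>i. x [^] (i::int) \<in> D \<Longrightarrow> int (p ^ e) dvd i"
  shows "\<exists>K. subgroup K G \<and> D \<subseteq> K \<and> (\<forall>i. x [^] (i::int) \<in> K \<longrightarrow> x [^] i \<in> D)
    \<and> carrier G = {x [^] (i::int) \<otimes> k | i k. k \<in> K}"
proof -
  define S where "S = {K. subgroup K G \<and> D \<subseteq> K \<and> (\<forall>i. x [^] (i::int) \<in> K \<longrightarrow> x [^] i \<in> D)}"
  have "S \<subseteq> Pow (carrier G)"
    by (auto simp: S_def dest: subgroup.subset)
  then have "finite S"
    using assms(1) by (meson finite_Pow_iff finite_subset)
  moreover have "D \<in> S"
    using D by (simp add: S_def)
  ultimately obtain K where K: "K \<in> S" and K_max: "\<And>M. M \<in> S \<Longrightarrow> K \<subseteq> M \<Longrightarrow> K = M"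
    using finite_has_maximal[of S] by blast
  from K have sK: "subgroup K G" and DK: "D \<subseteq> K" and int: "\<And>i. x [^] (i::int) \<in> K \<Longrightarrow> x [^] i \<in> D"
    by (auto simp: S_def)
  interpret K: subgroup K G by fact
  define L where "L = {x [^] (i::int) \<otimes> k | i k. k \<in> K}"
  have sL: "subgroup L G" and KL: "K \<subseteq> L" "x \<in> L"
    unfolding L_def using subgroup_adjoin[OF sK x] adjoin_incl[OF sK x] by auto
  interpret L: subgroup L G by fact
  have "carrier G \<subseteq> L"
  proof (rule ccontr)
    assume "\<not> carrier G \<subseteq> L"
    then obtain y0 where y0: "y0 \<in> carrier G" "y0 \<notin> L" by blast
    have "y0 [^] (p ^ n) \<in> L"
      using pow_order_eq_1[OF y0(1)] assms(3) by simp
    then obtain k where k: "y0 [^] (p ^ k) \<notin> L" "(y0 [^] (p ^ k)) [^] p \<in> L"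
      using exists_last_power_notin[OF y0] by blast
    \<comment> \<open>If \<open>L\<close> is proper, \<open>y\<close> lies outside it with its
      \<open>p\<close>-th power inside. The aim is a correction \<open>y'\<close> of
      \<open>y\<close> that can be adjoined to the maximal \<open>K\<close>.\<close>
    define y where "y = y0 [^] (p ^ k)"
    have y: "y \<in> carrier G" "y \<notin> L" "y [^] p \<in> L"
      using k y0 by (auto simp: y_def)
    obtain j l where jl: "y [^] p = x [^] (j::int) \<otimes> l" "l \<in> K"
      using y(3) by (auto simp: L_def)
    have e: "e \<noteq> 0"
      using exp[OF y(1)] y DK KL by (intro notI) auto
    then obtain e' where e': "e = Suc e'"
      using not0_implies_Suc by blast
    \<comment> \<open>Raising \<open>y [^] p = x [^] j \<otimes> l\<close> to the power
      \<open>p ^ e'\<close> puts \<open>x [^] (j * int (p ^ e'))\<close> into \<open>K\<close>, so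
      the order of \<open>x\<close> modulo \<open>D\<close> makes \<open>p\<close> divide
      \<open>j\<close>.\<close>
    have "y [^] (p ^ e) = (x [^] j \<otimes> l) [^] (p ^ e')"
      using y(1) by (simp add: e' nat_pow_pow flip: jl(1))
    also have "\<dots> = x [^] (j * int (p ^ e')) \<otimes> l [^] (p ^ e')"
      using x jl by (simp add: nat_pow_distrib int_pow_nat_pow)
    finally have "x [^] (j * int (p ^ e')) = y [^] (p ^ e) \<otimes> inv (l [^] (p ^ e'))"
      using x jl by (simp add: inv_solve_right m_assoc)
    moreover have "y [^] (p ^ e) \<in> K"
      using exp[OF y(1)] DK by blast
    moreover have "inv (l [^] (p ^ e')) \<in> K"
      using jl by (metis K.m_inv_closed int_pow_int subgroup_int_pow_closed sK)
    ultimately have "x [^] (j * int (p ^ e')) \<in> K"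
      by simp
    then have "int (p ^ e) dvd j * int (p ^ e')"
      using dvd int by blast
    then have "int p dvd j"
      using assms(2) by (auto simp: e' dest: prime_gt_0_nat)
    then obtain j' where j': "j = int p * j'" by blast
    \<comment> \<open>Dividing by a \<open>p\<close>-th root of \<open>x [^] j\<close> leaves
      \<open>y' [^] p = l\<close> in \<open>K\<close>, while \<open>y'\<close> stays outside
      \<open>L\<close>.\<close>
    define y' where "y' = y \<otimes> inv (x [^] j')"
    have y'c: "y' \<in> carrier G"
      using y x by (simp add: y'_def)
    have "y' [^] p = y [^] p \<otimes> inv (x [^] j)"
      using y x j' by (simp add: y'_def nat_pow_distrib nat_pow_inv int_pow_nat_pow mult.commute)
    also have "\<dots> = l"
      using jl x by (simp add: m_comm[of "x [^] j" l] m_assoc)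
    finally have y'p: "y' [^] p \<in> K"
      using jl by simp
    have y'L: "y' \<notin> L"
    proof
      assume "y' \<in> L"
      then have "y' \<otimes> x [^] j' \<in> L"
        using KL(2) by (simp add: subgroup_int_pow_closed sL)
      then show False
        using y x by (simp add: y'_def m_assoc)
    qed
    \<comment> \<open>A power of \<open>x\<close> in this larger group puts some
      \<open>y' [^] l\<close> into \<open>L\<close>. Then \<open>p\<close> divides \<open>l\<close>,
      so \<open>y' [^] l\<close> is already in \<open>K\<close>, and the power of \<open>x\<close>
      lies in \<open>D\<close>.\<close>
    have "{y' [^] (i::int) \<otimes> k | i k. k \<in> K} \<in> S"
    proof -
      have "x [^] i \<in> D" if "x [^] i = y' [^] (l::int) \<otimes> k" "k \<in> K" for i :: int and l k
      proof -
        have "y' [^] l = x [^] i \<otimes> inv k"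
          using that x y'c by (simp add: inv_solve_right)
        moreover have "x [^] i \<in> L"
          by (rule subgroup_int_pow_closed[OF sL KL(2)])
        moreover have "inv k \<in> L"
          using that(2) KL(1) by auto
        ultimately have "y' [^] l \<in> L"
          by simp
        then have "int p dvd l"
          using prime_dvd_of_int_pow_mem[OF assms(2) sL y'c y'L] y'p KL by blast
        then obtain m where "l = int p * m" by blast
        then have "y' [^] l = (y' [^] p) [^] m"
          using y'c by (simp add: int_pow_nat_pow)
        then have "y' [^] l \<in> K"
          using y'p by (simp add: subgroup_int_pow_closed sK)
        then have "x [^] i \<in> K"
          using that by simp
        then show ?thesis
          by (rule int)
      qed
      then show ?thesis
        using subgroup_adjoin[OF sK y'c] adjoin_incl[OF sK y'c] DK
        unfolding S_def by auto
    qed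
    then have "y' \<in> K"
      using K_max adjoin_incl[OF sK y'c] by blast
    then show False
      using y'L KL by blast
  qed
  then have "carrier G = L"
    using L.subset by blast
  then show ?thesis
    using sK DK int L_def by blast
qed

text \<open>With a complement \<open>K\<close> of \<open>x\<close> modulo \<open>D\<close>, the rule
  \<open>x [^] i \<otimes> k \<mapsto> c [^] i\<close> works. Two exponents for the same element
  differ by some \<open>i - j\<close> with \<open>x [^] (i - j)\<close> in \<open>K\<close>, hence
  in \<open>D\<close>, hence by a multiple of \<open>p ^ e\<close>, which kills
  \<open>c\<close>.\<close>

lemma (in comm_group) hom_extension:
  assumes "finite (carrier G)" "Factorial_Ring.prime p" "order G = p ^ n"
    and D: "subgroup D G" and x: "x \<in> carrier G"
    and exp: "\<And>y. y \<in> carrier G \<Longrightarrow> y [^] (p ^ e :: nat) \<in> D"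
    and dvd: "\<And>i. x [^] (i::int) \<in> D \<Longrightarrow> int (p ^ e) dvd i"
    and C: "comm_group C" and c: "c \<in> carrier C" "c [^]\<^bsub>C\<^esub> (p ^ e :: nat) = \<one>\<^bsub>C\<^esub>"
  shows "\<exists>\<psi>\<in>hom G C \<inter> extensional (carrier G). (\<forall>d\<in>D. \<psi> d = \<one>\<^bsub>C\<^esub>) \<and> \<psi> x = c"
proof -
  interpret C: comm_group C by fact
  obtain K where sK: "subgroup K G" and DK: "D \<subseteq> K"
    and int: "\<And>i. x [^] (i::int) \<in> K \<Longrightarrow> x [^] i \<in> D"
    and gen: "carrier G = {x [^] (i::int) \<otimes> k | i k. k \<in> K}"
    using complement_mod[OF assms(1-3) D x exp dvd] by blast
  interpret K: subgroup K G by fact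
  have wd: "c [^]\<^bsub>C\<^esub> i = c [^]\<^bsub>C\<^esub> j"
    if "x [^] (i::int) \<otimes> k = x [^] (j::int) \<otimes> l" "k \<in> K" "l \<in> K" for i j k l
  proof -
    have "x [^] i = x [^] j \<otimes> l \<otimes> inv k"
      using that x by (metis K.mem_carrier int_pow_closed inv_solve_right m_closed)
    then have "x [^] i \<otimes> inv (x [^] j) = l \<otimes> inv k"
      using that x by (simp add: m_ac inv_solve_right)
    then have "x [^] (i - j) \<in> K"
      using that x by (simp add: int_pow_diff)
    then have "int (p ^ e) dvd i - j"
      using int dvd by blast
    then obtain m where m: "i = j + int (p ^ e) * m"
      by (metis add.commute diff_add_cancel dvdE)
    have "c [^]\<^bsub>C\<^esub> i = c [^]\<^bsub>C\<^esub> j \<otimes>\<^bsub>C\<^esub> (c [^]\<^bsub>C\<^esub> (int (p ^ e))) [^]\<^bsub>C\<^esub> m"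
      unfolding m using c by (simp add: C.int_pow_mult C.int_pow_pow)
    also have "\<dots> = c [^]\<^bsub>C\<^esub> j"
      using c by (simp add: C.int_pow_one int_pow_int del: of_nat_power)
    finally show ?thesis .
  qed
  define \<psi> where "\<psi> = (\<lambda>y\<in>carrier G. c [^]\<^bsub>C\<^esub> (SOME i::int. \<exists>k\<in>K. y = x [^] i \<otimes> k))"
  have \<psi>: "\<psi> (x [^] i \<otimes> k) = c [^]\<^bsub>C\<^esub> i" if k: "k \<in> K" for i :: int and k
  proof -
    have "\<exists>l\<in>K. x [^] i \<otimes> k = x [^] (SOME j::int. \<exists>l\<in>K. x [^] i \<otimes> k = x [^] j \<otimes> l) \<otimes> l"
      by (rule someI_ex[where P = "\<lambda>j. \<exists>l\<in>K. x [^] i \<otimes> k = x [^] j \<otimes> l"]) (use k in blast)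
    then obtain l where "l \<in> K" and eq: "x [^] i \<otimes> k = x [^] (SOME j::int. \<exists>l\<in>K. x [^] i \<otimes> k = x [^] j \<otimes> l) \<otimes> l"
      by blast
    have "x [^] i \<otimes> k \<in> carrier G"
      using k x by simp
    then show ?thesis
      unfolding \<psi>_def restrict_apply using wd[OF eq k \<open>l \<in> K\<close>, symmetric] by (simp only: if_True)
  qed
  have "\<psi> \<in> hom G C"
  proof (rule homI)
    fix y assume "y \<in> carrier G"
    then show "\<psi> y \<in> carrier C"
      using c by (simp add: \<psi>_def)
  next
    fix y z assume "y \<in> carrier G" "z \<in> carrier G"
    then obtain i k j l where y: "y = x [^] (i::int) \<otimes> k" "k \<in> K" and z: "z = x [^] (j::int) \<otimes> l" "l \<in> K"
      unfolding gen by blast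
    then have "y \<otimes> z = x [^] (i + j) \<otimes> (k \<otimes> l)"
      using x by (simp add: int_pow_mult m_ac)
    then show "\<psi> (y \<otimes> z) = \<psi> y \<otimes>\<^bsub>C\<^esub> \<psi> z"
      using y z c by (simp add: \<psi> C.int_pow_mult)
  qed
  moreover have "\<psi> d = \<one>\<^bsub>C\<^esub>" if "d \<in> D" for d
    using \<psi>[of d 0] that DK D by (auto simp: subgroup.mem_carrier)
  moreover have "\<psi> x = c"
    using \<psi>[of \<one> 1] x c by (simp add: C.int_pow_1)
  moreover have "\<psi> \<in> extensional (carrier G)"
    by (simp add: \<psi>_def)
  ultimately show ?thesis by blast
qed

text \<open>This is \<open>Hom(G/D, C)\<close> without forming the quotient. Extensionality makes
  maps equal once they agree on \<open>carrier G\<close>, so that they can be counted.\<close>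

definition hom_group :: "('a, 'b) monoid_scheme \<Rightarrow> 'a set \<Rightarrow> ('c, 'd) monoid_scheme \<Rightarrow> ('a \<Rightarrow> 'c) monoid"
  where "hom_group G D C =
    \<lparr>carrier = {\<psi> \<in> hom G C \<inter> extensional (carrier G). \<forall>d\<in>D. \<psi> d = \<one>\<^bsub>C\<^esub>},
     monoid.mult = \<lambda>\<phi> \<psi>. \<lambda>x\<in>carrier G. \<phi> x \<otimes>\<^bsub>C\<^esub> \<psi> x,
     one = \<lambda>x\<in>carrier G. \<one>\<^bsub>C\<^esub>\<rparr>"

lemma (in group) group_hom_group:
  assumes "comm_group C" "D \<subseteq> carrier G"
  shows "group (hom_group G D C)"
proof -
  interpret C: comm_group C by fact
  show ?thesis
  proof (rule groupI)
    fix \<phi> \<psi> assume "\<phi> \<in> carrier (hom_group G D C)" "\<psi> \<in> carrier (hom_group G D C)"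
    then show "\<phi> \<otimes>\<^bsub>hom_group G D C\<^esub> \<psi> \<in> carrier (hom_group G D C)"
      using assms(2) by (auto simp: hom_group_def hom_def C.m_ac Pi_iff)
  next
    fix \<phi> \<psi> \<chi> assume "\<phi> \<in> carrier (hom_group G D C)" "\<psi> \<in> carrier (hom_group G D C)"
      "\<chi> \<in> carrier (hom_group G D C)"
    then show "\<phi> \<otimes>\<^bsub>hom_group G D C\<^esub> \<psi> \<otimes>\<^bsub>hom_group G D C\<^esub> \<chi> =
        \<phi> \<otimes>\<^bsub>hom_group G D C\<^esub> (\<psi> \<otimes>\<^bsub>hom_group G D C\<^esub> \<chi>)"
      by (auto simp: hom_group_def hom_def Pi_iff C.m_assoc)
  next
    fix \<phi> assume \<phi>: "\<phi> \<in> carrier (hom_group G D C)"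
    then show "\<one>\<^bsub>hom_group G D C\<^esub> \<otimes>\<^bsub>hom_group G D C\<^esub> \<phi> = \<phi>"
      by (auto simp: hom_group_def hom_def Pi_iff extensional_def)
    have "(\<lambda>x\<in>carrier G. inv\<^bsub>C\<^esub> \<phi> x) \<in> carrier (hom_group G D C)"
      using \<phi> assms(2) by (auto simp: hom_group_def hom_def Pi_iff C.inv_mult subset_iff)
    moreover have "(\<lambda>x\<in>carrier G. inv\<^bsub>C\<^esub> \<phi> x) \<otimes>\<^bsub>hom_group G D C\<^esub> \<phi> = \<one>\<^bsub>hom_group G D C\<^esub>"
      using \<phi> by (auto simp: hom_group_def hom_def Pi_iff)
    ultimately show "\<exists>\<chi>\<in>carrier (hom_group G D C). \<chi> \<otimes>\<^bsub>hom_group G D C\<^esub> \<phi> = \<one>\<^bsub>hom_group G D C\<^esub>"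
      by blast
  qed (use assms(2) in \<open>auto simp: hom_group_def hom_def\<close>)
qed

lemma (in comm_group) kernel_hom_group_eval:
  assumes "comm_group C" "subgroup D G" "x \<in> carrier G"
  shows "kernel (hom_group G D C) C (\<lambda>\<psi>. \<psi> x) =
    carrier (hom_group G {x [^] (i::int) \<otimes> k | i k. k \<in> D} C)" (is "?K = ?R")
proof
  interpret C: comm_group C by fact
  show "?K \<subseteq> ?R"
  proof
    fix \<psi> assume \<psi>: "\<psi> \<in> ?K"
    then interpret \<psi>: group_hom G C \<psi>
      by unfold_locales (auto simp: kernel_def hom_group_def)
    show "\<psi> \<in> ?R"
      using \<psi> assms by (auto simp: kernel_def hom_group_def \<psi>.hom_int_pow C.int_pow_one subgroup.mem_carrier)
  qed
  show "?R \<subseteq> ?K"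
    using adjoin_incl[OF assms(2,3)] by (auto simp: kernel_def hom_group_def)
qed

text \<open>Evaluation at \<open>x\<close> is a homomorphism into \<open>C\<close> whose kernel
  consists of the maps that also kill \<open>x\<close>. This allows \<open>Hom(G/D, C)\<close> to be
  counted one generator at a time.\<close>

lemma (in comm_group) card_hom_group_eval:
  assumes C: "comm_group C" and fin: "finite (carrier G)" "finite (carrier C)"
    and D: "subgroup D G" and x: "x \<in> carrier G"
  shows "card (carrier (hom_group G D C)) =
    card ((\<lambda>\<psi>. \<psi> x) ` carrier (hom_group G D C)) *
    card (carrier (hom_group G {x [^] (i::int) \<otimes> k | i k. k \<in> D} C))" (is ?card)
    and "subgroup ((\<lambda>\<psi>. \<psi> x) ` carrier (hom_group G D C)) C" (is ?sub)
proof -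
  interpret C: comm_group C by fact
  interpret H: group "hom_group G D C"
    using group_hom_group[OF C subgroup.subset[OF D]] .
  interpret ev: group_hom "hom_group G D C" C "\<lambda>\<psi>. \<psi> x"
    by unfold_locales (use x in \<open>auto simp: hom_group_def hom_def\<close>)
  have "carrier (hom_group G D C) \<subseteq> carrier G \<rightarrow>\<^sub>E carrier C"
    by (auto simp: hom_group_def hom_def PiE_def)
  then have "finite (carrier (hom_group G D C))"
    using fin by (meson finite_PiE finite_subset)
  then show ?card
    using ev.card_kernel_image kernel_hom_group_eval[OF C D x] by simp
  show ?sub
    by (rule ev.img_is_subgroup)
qed

text \<open>Here \<open>p ^ e\<close> is the exponent of \<open>G/D\<close>. Minimality of
  \<open>e\<close> yields an \<open>x\<close> whose \<open>p ^ (e - 1)\<close>-th power is outside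
  \<open>D\<close>, and the gcd argument then shows that \<open>x\<close> has order exactly
  \<open>p ^ e\<close> modulo \<open>D\<close>.\<close>

lemma (in comm_group) exists_max_order_mod:
  assumes "finite (carrier G)" "Factorial_Ring.prime p" "order G = p ^ n" and D: "subgroup D G"
  shows "\<exists>x\<in>carrier G. \<exists>e. (\<forall>y\<in>carrier G. y [^] (p ^ e :: nat) \<in> D) \<and>
    (\<forall>i::int. x [^] i \<in> D \<longrightarrow> int (p ^ e) dvd i)"
proof -
  have "y [^] (p ^ n) \<in> D" if "y \<in> carrier G" for y
    using pow_order_eq_1[OF that] D assms(3) by (simp add: subgroup.one_closed)
  then have ex: "\<forall>y\<in>carrier G. y [^] (p ^ n) \<in> D" by blast
  define e where "e = (LEAST e. \<forall>y\<in>carrier G. y [^] (p ^ e :: nat) \<in> D)"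
  have e: "\<forall>y\<in>carrier G. y [^] (p ^ e :: nat) \<in> D"
    unfolding e_def by (rule LeastI) (rule ex)
  show ?thesis
  proof (cases e)
    case 0
    then show ?thesis using e by (intro bexI[of _ \<one>] exI[of _ 0]) auto
  next
    case (Suc e')
    then have "\<not> (\<forall>y\<in>carrier G. y [^] (p ^ e') \<in> D)"
      using not_less_Least[of e' "\<lambda>e. \<forall>y\<in>carrier G. y [^] (p ^ e :: nat) \<in> D"] by (simp add: e_def)
    then obtain x where x: "x \<in> carrier G" "x [^] (p ^ e') \<notin> D" by blast
    have "int (p ^ e) dvd i" if i: "x [^] (i::int) \<in> D" for i
    proof -
      have "x [^] (int (p ^ e)) \<in> D"
        using e x by (simp add: int_pow_int del: of_nat_power)
      then have gcd: "x [^] gcd i (int (p ^ e)) \<in> D"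
        using int_pow_gcd_mem[OF D x(1) i] by blast
      have "nat (gcd i (int (p ^ e))) dvd p ^ e"
        by (metis gcd_dvd2 gcd_ge_0_int int_dvd_int_iff int_nat_eq)
      then obtain k where k: "k \<le> e" "nat (gcd i (int (p ^ e))) = p ^ k"
        using divides_primepow_nat[OF assms(2)] by blast
      then have k': "gcd i (int (p ^ e)) = int (p ^ k)"
        by (metis gcd_ge_0_int int_nat_eq)
      show ?thesis
      proof (cases "k = e")
        case True
        then show ?thesis using k' by (metis gcd_dvd1)
      next
        case False
        then have "x [^] (p ^ e') = (x [^] (p ^ k)) [^] (p ^ (e' - k))"
          using k Suc x by (simp add: nat_pow_pow flip: power_add)
        moreover have "x [^] (p ^ k) \<in> D"
          using gcd k' by (simp add: int_pow_int del: of_nat_power)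
        ultimately have "x [^] (p ^ e') \<in> D"
          using subgroup_int_pow_closed[OF D, of _ "int (p ^ (e' - k))"] by (simp add: int_pow_int del: of_nat_power)
        then show ?thesis using x by blast
      qed
    qed
    then show ?thesis using e x by blast
  qed
qed

text \<open>The hypothesis \<open>exp\<close> says that the exponent of \<open>C\<close> divides
  that of \<open>G/D\<close>. Evaluation at an \<open>x\<close> of maximal order modulo
  \<open>D\<close> is therefore onto \<open>C\<close>, which gives the factor
  \<open>order C\<close>. Its kernel is \<open>Hom(G/D', C)\<close> with \<open>D'\<close> generated
  by \<open>D\<close> and \<open>x\<close>; if \<open>D'\<close> is proper and \<open>C\<close>
  nontrivial, evaluation at a second element has an image of order divisible by
  \<open>p\<close>.\<close>

lemma (in comm_group) card_dvd_card_hom_group: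
  assumes fin: "finite (carrier G)" and p: "Factorial_Ring.prime p" and ord: "order G = p ^ n"
    and D: "subgroup D G"
    and C: "comm_group C" "order C = p ^ m"
    and exp: "\<And>e c. (\<And>y. y \<in> carrier G \<Longrightarrow> y [^] (p ^ e :: nat) \<in> D) \<Longrightarrow> c \<in> carrier C
      \<Longrightarrow> c [^]\<^bsub>C\<^esub> (p ^ e :: nat) = \<one>\<^bsub>C\<^esub>"
  shows "order C dvd card (carrier (hom_group G D C))"
    and "\<lbrakk>\<And>x. x \<in> carrier G \<Longrightarrow> carrier G \<noteq> {x [^] (i::int) \<otimes> k | i k. k \<in> D}; m \<noteq> 0\<rbrakk>
      \<Longrightarrow> p * order C dvd card (carrier (hom_group G D C))"
proof -
  interpret C: comm_group C by fact
  have finC: "finite (carrier C)"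
    using C(2) p by (metis C.order_gt_0_iff_finite prime_gt_0_nat zero_less_power)
  obtain x e where x: "x \<in> carrier G" and e: "\<And>y. y \<in> carrier G \<Longrightarrow> y [^] (p ^ e :: nat) \<in> D"
    and dvd: "\<And>i. x [^] (i::int) \<in> D \<Longrightarrow> int (p ^ e) dvd i"
    using exists_max_order_mod[OF fin p ord D] by blast
  define D' where "D' = {x [^] (i::int) \<otimes> k | i k. k \<in> D}"
  have D': "subgroup D' G"
    unfolding D'_def by (rule subgroup_adjoin[OF D x])
  have "\<exists>\<psi>\<in>carrier (hom_group G D C). \<psi> x = c" if "c \<in> carrier C" for c
    using hom_extension[OF fin p ord D x e dvd C(1) that exp[OF e that]]
    by (auto simp: hom_group_def)
  moreover have "(\<lambda>\<psi>. \<psi> x) ` carrier (hom_group G D C) \<subseteq> carrier C"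
    using x by (auto simp: hom_group_def hom_def)
  ultimately have "(\<lambda>\<psi>. \<psi> x) ` carrier (hom_group G D C) = carrier C"
    by (auto simp: image_iff)
  then have card: "card (carrier (hom_group G D C)) = order C * card (carrier (hom_group G D' C))"
    using card_hom_group_eval(1)[OF C(1) fin finC D x] by (simp add: D'_def order_def)
  then show "order C dvd card (carrier (hom_group G D C))"
    by simp
  assume "\<And>x. x \<in> carrier G \<Longrightarrow> carrier G \<noteq> {x [^] (i::int) \<otimes> k | i k. k \<in> D}" and m: "m \<noteq> 0"
  then have D'_ne: "D' \<noteq> carrier G"
    using x by (auto simp: D'_def)
  obtain y f where y: "y \<in> carrier G" and f: "\<And>z. z \<in> carrier G \<Longrightarrow> z [^] (p ^ f :: nat) \<in> D'"
    and dvd': "\<And>i. y [^] (i::int) \<in> D' \<Longrightarrow> int (p ^ f) dvd i"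
    using exists_max_order_mod[OF fin p ord D'] by blast
  have "f \<noteq> 0"
    using f D'_ne subgroup.subset[OF D'] by (intro notI) auto
  then obtain f' where f': "f = Suc f'"
    using not0_implies_Suc by blast
  obtain c0 where c0: "c0 \<in> carrier C" "c0 \<noteq> \<one>\<^bsub>C\<^esub>"
  proof -
    have "carrier C \<noteq> {\<one>\<^bsub>C\<^esub>}"
      using C(2) m one_less_power[OF prime_gt_1_nat[OF p], of m] by (auto simp: order_def)
    then show ?thesis using that C.one_closed by blast
  qed
  have "c0 [^]\<^bsub>C\<^esub> (p ^ m) \<in> {\<one>\<^bsub>C\<^esub>}"
    using C.pow_order_eq_1[OF c0(1)] C(2) by simp
  then obtain k where k: "c0 [^]\<^bsub>C\<^esub> (p ^ k) \<notin> {\<one>\<^bsub>C\<^esub>}" "(c0 [^]\<^bsub>C\<^esub> (p ^ k)) [^]\<^bsub>C\<^esub> p \<in> {\<one>\<^bsub>C\<^esub>}"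
    using C.exists_last_power_notin[OF c0(1), of "{\<one>\<^bsub>C\<^esub>}" p m] c0(2) by blast
  \<comment> \<open>An element of order \<open>p\<close> in \<open>C\<close> is a possible value at
    \<open>y\<close>, because \<open>f\<close> is positive.\<close>
  define c where "c = c0 [^]\<^bsub>C\<^esub> (p ^ k)"
  have c: "c \<in> carrier C" "c \<noteq> \<one>\<^bsub>C\<^esub>" "c [^]\<^bsub>C\<^esub> p = \<one>\<^bsub>C\<^esub>"
    using k c0 by (auto simp: c_def)
  then have "c [^]\<^bsub>C\<^esub> (p ^ f) = \<one>\<^bsub>C\<^esub>"
    by (simp add: f' flip: C.nat_pow_pow)
  then obtain \<psi> where \<psi>: "\<psi> \<in> carrier (hom_group G D' C)" "\<psi> y = c"
    using hom_extension[OF fin p ord D' y f dvd' C(1) c(1)] by (auto simp: hom_group_def)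
  define I where "I = (\<lambda>\<psi>. \<psi> y) ` carrier (hom_group G D' C)"
  have I: "subgroup I C"
    unfolding I_def by (rule card_hom_group_eval(2)[OF C(1) fin finC D' y])
  have "c \<in> I"
    using \<psi> by (auto simp: I_def)
  have "card I dvd p ^ m"
    using C.lagrange[OF I] C(2) by (metis dvd_triv_right)
  then obtain l where l: "card I = p ^ l"
    using divides_primepow_nat[OF p] by blast
  have "l \<noteq> 0"
  proof
    assume "l = 0"
    then obtain z where "I = {z}"
      using l by (auto simp: card_1_singleton_iff)
    then show False
      using \<open>c \<in> I\<close> c subgroup.one_closed[OF I] by blast
  qed
  then have "p dvd card I"
    using l by simp
  then have "p dvd card (carrier (hom_group G D' C))"
    using card_hom_group_eval(1)[OF C(1) fin finC D' y] by (simp add: I_def)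
  then show "p * order C dvd card (carrier (hom_group G D C))"
    by (simp add: card mult.commute mult_dvd_mono)
qed

section \<open>Extensions of abelian groups by a cyclic group of order \<open>p\<close>\<close>

lemma (in group) mult_inv_cancel:
  assumes "x \<in> carrier G" "y \<in> carrier G"
  shows "x \<otimes> (inv x \<otimes> y) = y" "inv x \<otimes> (x \<otimes> y) = y"
  using assms by (simp_all flip: m_assoc)

lemmas (in group) group_normalize = m_assoc mult_inv_cancel inv_mult_group

text \<open>\<open>A\<close> is an abelian normal subgroup and \<open>G/A\<close> is cyclic of order
  \<open>p\<close>, generated by the class of \<open>g\<close>. Maximality is kept only in this
  explicit form, so that the results can be applied again to another subgroup with another
  generator.\<close>

locale cyclic_extension = group G for G (structure) +
  fixes A :: "'a set" and g :: 'a and p n :: nat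
  assumes prime_p: "Factorial_Ring.prime p"
    and finite_carrier: "finite (carrier G)"
    and order_eq: "order G = p ^ n"
    and A_subgroup: "subgroup A G"
    and A_comm: "\<And>x y. \<lbrakk>x \<in> A; y \<in> A\<rbrakk> \<Longrightarrow> x \<otimes> y = y \<otimes> x"
    and g_carrier: "g \<in> carrier G"
    and g_notin: "g \<notin> A"
    and g_pow_p: "g [^] p \<in> A"
    and conj_mem: "\<And>a. a \<in> A \<Longrightarrow> g \<otimes> a \<otimes> inv g \<in> A"
    and generated: "\<And>x. x \<in> carrier G \<Longrightarrow> \<exists>a\<in>A. \<exists>i::nat. x = a \<otimes> g [^] i"
begin

sublocale A: subgroup A G
  by (rule A_subgroup)

abbreviation AG where "AG \<equiv> G\<lparr>carrier := A\<rparr>"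

lemma comm_group_sub:
  assumes "subgroup K G" "K \<subseteq> A"
  shows "comm_group (G\<lparr>carrier := K\<rparr>)"
  by (rule group.group_comm_groupI[OF subgroup_imp_group[OF assms(1)]]) (use assms A_comm in auto)

sublocale AG: comm_group AG
  by (rule comm_group_sub[OF A_subgroup]) simp

lemmas A_ac = AG.m_ac[simplified]

definition conj :: "nat \<Rightarrow> 'a \<Rightarrow> 'a"
  where "conj i a = g [^] i \<otimes> a \<otimes> inv (g [^] i)"

text \<open>This is the product of \<open>conj i a\<close> over \<open>i < k\<close>, as the
  recursion for \<open>Suc k\<close> shows. The closed form makes the value of
  \<open>(a \<otimes> g) [^] p\<close> immediate.\<close>

definition partial_norm :: "nat \<Rightarrow> 'a \<Rightarrow> 'a"
  where "partial_norm k a = (a \<otimes> g) [^] k \<otimes> inv (g [^] k)"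

definition norm :: "'a \<Rightarrow> 'a"
  where "norm = partial_norm p"

definition D :: "'a set"
  where "D = (\<lambda>a. conj 1 a \<otimes> inv a) ` A"

definition C :: "'a set"
  where "C = norm ` A"

section \<open>The action of \<open>g\<close> on \<open>A\<close>, its norm map, and the subgroups
  \<open>C\<close> and \<open>D\<close>\<close>

lemma g_pow [simp]: "g [^] (i::nat) \<in> carrier G"
  using g_carrier by simp

lemma conj_0 [simp]: "a \<in> A \<Longrightarrow> conj 0 a = a"
  by (simp add: conj_def)

lemma conj_conj:
  assumes "a \<in> carrier G"
  shows "conj i (conj j a) = conj (i + j) a"
  using assms by (simp add: conj_def group_normalize flip: nat_pow_mult[OF g_carrier])

lemma conj_closed [simp]: "a \<in> A \<Longrightarrow> conj i a \<in> A"
proof (induction i)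
  case (Suc i)
  then have "conj 1 (conj i a) \<in> A"
    using conj_mem g_carrier by (simp add: conj_def)
  then show ?case
    using Suc.prems conj_conj[of a 1 i] by simp
qed simp

lemma conj_carrier [simp]: "a \<in> carrier G \<Longrightarrow> conj i a \<in> carrier G"
  by (simp add: conj_def)

lemma conj_mult: "\<lbrakk>a \<in> carrier G; b \<in> carrier G\<rbrakk> \<Longrightarrow> conj i (a \<otimes> b) = conj i a \<otimes> conj i b"
  by (simp add: conj_def group_normalize)

lemma pow_mult_eq: "a \<in> carrier G \<Longrightarrow> g [^] i \<otimes> a = conj i a \<otimes> g [^] (i::nat)"
  by (simp add: conj_def group_normalize)

lemma conj_hom: "conj i \<in> hom AG AG"
  by (rule homI) (simp_all add: conj_mult)

lemma conj_of_pow: "conj p a = a" if "a \<in> A"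
proof -
  have "g [^] p \<otimes> a = a \<otimes> g [^] p"
    using A_comm[OF g_pow_p that] .
  then show ?thesis
    using that by (simp add: conj_def group_normalize)
qed

lemma partial_norm_Suc:
  assumes "a \<in> A"
  shows "partial_norm (Suc k) a = partial_norm k a \<otimes> conj k a"
  using assms g_carrier by (simp add: partial_norm_def conj_def group_normalize)

lemma partial_norm_closed: "a \<in> A \<Longrightarrow> partial_norm k a \<in> A"
  by (induction k) (simp_all add: partial_norm_Suc, simp add: partial_norm_def)

lemma partial_norm_mult:
  assumes "a \<in> A" "b \<in> A"
  shows "partial_norm k (a \<otimes> b) = partial_norm k a \<otimes> partial_norm k b"
proof (induction k)
  case 0
  then show ?case by (simp add: partial_norm_def)
next
  case (Suc k)
  have "partial_norm k a \<otimes> partial_norm k b \<otimes> (conj k a \<otimes> conj k b) =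
      partial_norm k a \<otimes> conj k a \<otimes> (partial_norm k b \<otimes> conj k b)"
    using assms by (simp add: partial_norm_closed A_ac)
  then show ?case
    using Suc assms by (simp add: partial_norm_Suc conj_mult)
qed

lemma norm_closed [simp]: "a \<in> A \<Longrightarrow> norm a \<in> A"
  by (simp add: norm_def partial_norm_closed)

lemma norm_hom: "norm \<in> hom AG AG"
  by (rule homI) (simp_all add: norm_def partial_norm_closed partial_norm_mult)

sublocale norm: group_hom AG AG norm
  by unfold_locales (rule norm_hom)

lemma norm_eq: "a \<in> A \<Longrightarrow> (a \<otimes> g) [^] p = norm a \<otimes> g [^] p"
  using g_carrier by (simp add: norm_def partial_norm_def group_normalize)

lemma central_iff:
  assumes "c \<in> A"
  shows "(\<forall>x\<in>carrier G. x \<otimes> c = c \<otimes> x) \<longleftrightarrow> g \<otimes> c = c \<otimes> g"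
proof
  assume gc: "g \<otimes> c = c \<otimes> g"
  show "\<forall>x\<in>carrier G. x \<otimes> c = c \<otimes> x"
  proof
    fix x assume "x \<in> carrier G"
    then obtain a and i :: nat where x: "x = a \<otimes> g [^] i" "a \<in> A"
      using generated by blast
    have "g [^] i \<otimes> c = c \<otimes> g [^] i"
      using group_commutes_pow[OF gc g_carrier] assms by simp
    then have "x \<otimes> c = (a \<otimes> c) \<otimes> g [^] i"
      using x assms by (simp add: m_assoc)
    also have "\<dots> = c \<otimes> x"
      using x assms A_comm[of a c] by (simp add: m_assoc)
    finally show "x \<otimes> c = c \<otimes> x" .
  qed
qed (use g_carrier in auto)

text \<open>The element \<open>(a \<otimes> g) [^] p\<close> commutes with
  \<open>a \<otimes> g\<close> and, lying in \<open>A\<close>, with \<open>a\<close>; so it commutes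
  with \<open>g\<close>. So does \<open>g [^] p\<close>, hence also the quotient
  \<open>norm a\<close>, and an element of \<open>A\<close> commuting with \<open>g\<close> is
  central.\<close>

lemma norm_central:
  assumes "a \<in> A"
  shows "x \<in> carrier G \<Longrightarrow> x \<otimes> norm a = norm a \<otimes> x"
proof -
  let ?w = "(a \<otimes> g) [^] p" and ?z = "g [^] p"
  have z: "?z \<in> A" "?w \<in> A"
    using assms g_pow_p by (auto simp: norm_eq)
  have ag: "a \<otimes> g \<in> carrier G"
    using assms g_carrier by simp
  have w_ag: "?w \<otimes> (a \<otimes> g) = a \<otimes> g \<otimes> ?w"
    by (metis ag nat_pow_Suc nat_pow_Suc2)
  have "a \<otimes> (g \<otimes> ?w) = a \<otimes> (?w \<otimes> g)"
    using w_ag A_comm[OF assms z(2)] assms g_carrier z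
    by (metis A.mem_carrier m_assoc)
  then have gw: "g \<otimes> ?w = ?w \<otimes> g"
    using assms g_carrier z by simp
  have gz: "g \<otimes> inv ?z = inv ?z \<otimes> g"
  proof -
    have "g \<otimes> ?z = ?z \<otimes> g"
      by (metis g_carrier nat_pow_Suc nat_pow_Suc2)
    then show ?thesis
      using g_carrier by (metis g_pow inv_closed inv_solve_left inv_solve_right m_assoc m_closed)
  qed
  have "g \<otimes> norm a = ?w \<otimes> (g \<otimes> inv ?z)"
    using gw z g_carrier by (simp add: norm_def partial_norm_def flip: m_assoc)
  also have "\<dots> = norm a \<otimes> g"
    using gz z g_carrier by (simp add: norm_def partial_norm_def m_assoc)
  finally show "x \<in> carrier G \<Longrightarrow> x \<otimes> norm a = norm a \<otimes> x"
    using central_iff[of "norm a"] assms by simp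
qed

lemma conj_norm: "a \<in> A \<Longrightarrow> conj i (norm a) = norm a"
  using norm_central[of a "g [^] i"] by (simp add: conj_def m_assoc)

text \<open>Conjugation by \<open>g\<close> sends \<open>b \<otimes> g\<close> to
  \<open>conj 1 b \<otimes> g\<close> but fixes the \<open>p\<close>-th power
  \<open>norm b \<otimes> g [^] p\<close>, both of whose factors commute with
  \<open>g\<close>.\<close>

lemma norm_conj:
  assumes "a \<in> A"
  shows "norm (conj i a) = norm a"
proof -
  have step: "norm (conj 1 b) = norm b" if "b \<in> A" for b
  proof -
    have "conj 1 b \<otimes> g = conj 1 (b \<otimes> g)"
      using that g_carrier by (simp add: conj_def group_normalize)
    moreover have "conj 1 (b \<otimes> g) [^] k = conj 1 ((b \<otimes> g) [^] k)" for k :: nat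
    proof (induction k)
      case (Suc k)
      then show ?case using that g_carrier by (simp add: conj_mult)
    qed (use g_carrier in \<open>simp add: conj_def\<close>)
    ultimately have "(conj 1 b \<otimes> g) [^] p = conj 1 (norm b \<otimes> g [^] p)"
      using that by (simp add: norm_eq)
    also have "\<dots> = norm b \<otimes> conj 1 (g [^] p)"
      using that by (simp add: conj_mult conj_norm del: One_nat_def)
    also have "conj 1 (g [^] p) = g [^] p"
    proof -
      have "g \<otimes> g [^] p = g [^] p \<otimes> g"
        by (metis g_carrier nat_pow_Suc nat_pow_Suc2)
      then show ?thesis using g_carrier by (simp add: conj_def m_assoc)
    qed
    finally have "norm (conj 1 b) \<otimes> g [^] p = norm b \<otimes> g [^] p"
      using norm_eq[of "conj 1 b"] that by simp
    then show ?thesis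
      using that by simp
  qed
  show ?thesis
    using assms
  proof (induction i)
    case (Suc i)
    then show ?case
      using step[of "conj i a"] conj_conj[of a 1 i] by simp
  qed simp
qed

lemma D_subgroup: "subgroup D G" and D_subset: "D \<subseteq> A"
proof -
  have "(\<lambda>a. conj 1 a \<otimes> inv a) \<in> hom AG AG"
    by (rule homI) (simp_all add: conj_mult A_ac inv_mult_group del: One_nat_def)
  then interpret h: group_hom AG AG "\<lambda>a. conj 1 a \<otimes> inv a"
    by unfold_locales
  have "subgroup D AG"
    using h.img_is_subgroup by (simp add: D_def)
  then show "subgroup D G"
    using incl_subgroup A_subgroup by blast
  show "D \<subseteq> A"
    by (auto simp: D_def simp del: One_nat_def)
qed

lemma C_subgroup: "subgroup C G" and C_subset: "C \<subseteq> A"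
  using incl_subgroup[OF A_subgroup] norm.img_is_subgroup by (auto simp: C_def)

sublocale D: subgroup D G by (rule D_subgroup)
sublocale C: subgroup C G by (rule C_subgroup)

lemma norm_D: "d \<in> D \<Longrightarrow> norm d = \<one>"
  using norm_conj norm.hom_mult norm.hom_inv by (auto simp: D_def m_inv_consistent[OF A_subgroup])

lemma conj_mod_D:
  assumes "a \<in> A"
  shows "conj i a \<otimes> inv a \<in> D"
proof (induction i)
  case 0
  then show ?case using assms D.one_closed by simp
next
  case (Suc i)
  have "conj 1 (conj i a) \<otimes> inv (conj i a) \<in> D"
    using assms by (auto simp: D_def)
  then have "(conj 1 (conj i a) \<otimes> inv (conj i a)) \<otimes> (conj i a \<otimes> inv a) \<in> D"
    using Suc by blast
  moreover have "(conj 1 (conj i a) \<otimes> inv (conj i a)) \<otimes> (conj i a \<otimes> inv a) = conj (Suc i) a \<otimes> inv a"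
    using assms conj_conj[of a 1 i] by (simp add: group_normalize)
  ultimately show ?case by simp
qed

text \<open>The action of \<open>g\<close> on \<open>A/D\<close> is trivial, so each of the
  \<open>p\<close> factors of the norm is \<open>a\<close> modulo \<open>D\<close>.\<close>

lemma norm_mod_D:
  assumes "a \<in> A"
  shows "\<exists>d\<in>D. norm a = a [^] p \<otimes> d"
proof -
  have "\<exists>d\<in>D. partial_norm k a = a [^] k \<otimes> d" for k
  proof (induction k)
    case 0
    then show ?case using D.one_closed by (auto simp: partial_norm_def)
  next
    case (Suc k)
    then obtain d where d: "d \<in> D" "partial_norm k a = a [^] k \<otimes> d" by blast
    have "partial_norm (Suc k) a = a [^] k \<otimes> d \<otimes> conj k a"
      using assms d by (simp add: partial_norm_Suc)
    also have "\<dots> = a [^] k \<otimes> d \<otimes> (conj k a \<otimes> inv a \<otimes> a)"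
      using assms by (simp add: m_assoc)
    also have "\<dots> = a [^] Suc k \<otimes> (d \<otimes> (conj k a \<otimes> inv a))"
    proof -
      have "a [^] k \<in> A" "d \<in> A" "conj k a \<otimes> inv a \<in> A"
        using assms d D_subset nat_pow_consistent[of a k A] AG.nat_pow_closed by auto
      then show ?thesis
        using assms by (simp add: A_ac)
    qed
    finally show ?case
      using d conj_mod_D[OF assms] by blast
  qed
  then show ?thesis by (simp add: norm_def)
qed

lemma pow_closed [simp]: "a \<in> A \<Longrightarrow> a [^] (k::nat) \<in> A"
  by (metis A_subgroup int_pow_int subgroup_int_pow_closed)

lemma pow_mem_iff: "g [^] (i::nat) \<in> A \<longleftrightarrow> p dvd i"
proof
  assume "g [^] i \<in> A"
  then show "p dvd i"
    using prime_dvd_of_int_pow_mem[OF prime_p A_subgroup g_carrier g_notin g_pow_p, of "int i"]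
    by (simp add: int_pow_int)
next
  assume "p dvd i"
  then obtain k where "i = p * k" by blast
  then show "g [^] i \<in> A"
    using pow_closed[OF g_pow_p, of k] g_carrier by (simp add: nat_pow_pow)
qed

text \<open>Each element is \<open>a \<otimes> g [^] i\<close> with \<open>i < p\<close> for a
  unique pair: if two such forms agree, \<open>p\<close> divides the difference of their
  exponents.\<close>

lemma card_A: "order G = p * card A"
proof -
  have "bij_betw (\<lambda>(a, i). a \<otimes> g [^] i) (A \<times> {..<p}) (carrier G)"
  proof (rule bij_betwI')
    fix u v assume u: "u \<in> A \<times> {..<p}" and v: "v \<in> A \<times> {..<p}"
    obtain a i b j where ab: "u = (a, i)" "v = (b, j)" by (cases u, cases v) auto
    have *: "i = j \<and> a = b"
      if "a \<otimes> g [^] i = b \<otimes> g [^] j" "i \<le> j" "j < p" "a \<in> A" "b \<in> A" for a b and i j :: nat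
    proof -
      have "a \<otimes> g [^] i = b \<otimes> g [^] (j - i) \<otimes> g [^] i"
        using that g_carrier by (simp add: m_assoc nat_pow_mult)
      then have eq: "a = b \<otimes> g [^] (j - i)"
        using that g_carrier by simp
      then have "g [^] (j - i) = inv b \<otimes> a"
        using that by (simp add: mult_inv_cancel)
      then have "p dvd j - i"
        using that by (simp flip: pow_mem_iff)
      then have "i = j"
        using that by (metis diff_is_0_eq dvd_imp_le le_antisym less_imp_diff_less not_gr_zero not_less)
      then show ?thesis using eq that by simp
    qed
    show "((case u of (a, i) \<Rightarrow> a \<otimes> g [^] i) = (case v of (a, i) \<Rightarrow> a \<otimes> g [^] i)) = (u = v)"
      using *[of a i b j] *[of b j a i] u v ab by (cases "i \<le> j") auto
  next
    fix u assume "u \<in> A \<times> {..<p}"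
    then show "(case u of (a, i) \<Rightarrow> a \<otimes> g [^] i) \<in> carrier G" by auto
  next
    fix x assume "x \<in> carrier G"
    then obtain a and i :: nat where x: "x = a \<otimes> g [^] i" "a \<in> A"
      using generated by blast
    have "x = (a \<otimes> g [^] (p * (i div p))) \<otimes> g [^] (i mod p)"
      using x g_carrier by (simp add: m_assoc nat_pow_mult)
    moreover have "a \<otimes> g [^] (p * (i div p)) \<in> A"
      using x pow_mem_iff by simp
    moreover have "i mod p < p"
      using prime_p by (simp add: prime_gt_0_nat)
    ultimately show "\<exists>u\<in>A \<times> {..<p}. x = (case u of (a, i) \<Rightarrow> a \<otimes> g [^] i)"
      by (intro bexI[of _ "(a \<otimes> g [^] (p * (i div p)), i mod p)"]) auto
  qed
  from bij_betw_same_card[OF this] show ?thesis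
    by (simp add: order_def card_cartesian_product mult.commute)
qed

lemma finite_A: "finite A"
  using finite_carrier A.subset finite_subset by blast

lemma card_A_norm: "card A = card C * card (kernel AG AG norm)"
  using norm.card_kernel_image finite_A by (simp add: C_def)

end

lemma (in group) finite_mult_closed_subgroup:
  assumes "finite (carrier G)" "S \<subseteq> carrier G" "S \<noteq> {}"
    and closed: "\<And>x y. \<lbrakk>x \<in> S; y \<in> S\<rbrakk> \<Longrightarrow> x \<otimes> y \<in> S"
  shows "subgroup S G"
proof (rule subgroupI)
  fix x assume x: "x \<in> S"
  then have xG: "x \<in> carrier G" using assms(2) by blast
  have pow: "x [^] Suc k \<in> S" for k
    by (induction k) (use x xG closed in auto)
  have "0 < order G"
    using assms(1) order_gt_0_iff_finite by blast
  \<comment> \<open>The order is doubled so that the exponent of the inverse,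
    \<open>2 * order G - 1\<close>, is positive even in the trivial group; only positive powers are
    known to lie in \<open>S\<close>.\<close>
  then have "2 \<le> 2 * order G"
    by simp
  then obtain k where k: "2 * order G = Suc (Suc k)"
    by (metis le_Suc_ex add_2_eq_Suc)
  have "x [^] (order G * 2) = \<one>"
    using pow_order_eq_1[OF xG] by (simp add: xG flip: nat_pow_pow)
  then have "x [^] Suc k \<otimes> x = \<one>"
    using k by (simp add: mult.commute)
  then have "inv x = x [^] Suc k"
    using xG by (intro inv_equality) auto
  then show "inv x \<in> S"
    using pow by simp
qed (use assms in auto)

text \<open>In a finite group closure under composition already gives a subgroup, so Lagrange
  applies to \<open>P\<close>.\<close>

lemma (in group) order_AutoGroup_dvdI:
  assumes "finite (carrier G)" "P \<subseteq> auto G" "P \<noteq> {}"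
    and "\<And>\<alpha> \<beta>. \<lbrakk>\<alpha> \<in> P; \<beta> \<in> P\<rbrakk> \<Longrightarrow> compose (carrier G) \<alpha> \<beta> \<in> P"
  shows "card P dvd order (AutoGroup G)"
proof -
  interpret Aut: group "AutoGroup G" by (rule AutoGroup)
  have carrier: "carrier (AutoGroup G) = auto G"
    by (simp add: AutoGroup_def)
  have "auto G \<subseteq> carrier G \<rightarrow>\<^sub>E carrier G"
    by (auto simp: auto_def hom_def Bij_def PiE_def)
  then have fin: "finite (auto G)"
    using assms(1) by (meson finite_PiE finite_subset)
  have "\<alpha> \<otimes>\<^bsub>AutoGroup G\<^esub> \<beta> = compose (carrier G) \<alpha> \<beta>" if "\<alpha> \<in> P" "\<beta> \<in> P" for \<alpha> \<beta>
    using that assms(2) by (auto simp: AutoGroup_def BijGroup_def auto_def)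
  then have "subgroup P (AutoGroup G)"
    using assms fin carrier by (intro Aut.finite_mult_closed_subgroup) auto
  then show ?thesis
    using Aut.lagrange by (metis dvd_triv_right)
qed

section \<open>Extending automorphisms of \<open>A\<close> to \<open>G\<close>, and counting the
  extensions\<close>

context cyclic_extension
begin

text \<open>If an extension sends \<open>g\<close> to \<open>c \<otimes> g\<close>, then
  \<open>\<phi> (g [^] p)\<close> must be \<open>(c \<otimes> g) [^] p\<close>, that is
  \<open>norm c \<otimes> g [^] p\<close>. The last condition says that such a \<open>c\<close>
  exists.\<close>

definition compatible :: "('a \<Rightarrow> 'a) \<Rightarrow> bool"
  where "compatible \<phi> \<longleftrightarrow> \<phi> \<in> hom AG AG \<inter> extensional A \<and> inj_on \<phi> A \<and>
    (\<forall>a\<in>A. \<phi> (conj 1 a) = conj 1 (\<phi> a)) \<and> \<phi> (g [^] p) \<otimes> inv (g [^] p) \<in> C"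

lemma compatible_conj:
  assumes "compatible \<phi>" "a \<in> A"
  shows "\<phi> (conj i a) = conj i (\<phi> a)"
proof (induction i)
  case 0
  then show ?case using assms by (simp add: compatible_def hom_def Pi_iff)
next
  case (Suc i)
  have "\<phi> a \<in> A" using assms by (simp add: compatible_def hom_def Pi_iff)
  then show ?case
    using assms Suc conj_conj[of a 1 i] conj_conj[of "\<phi> a" 1 i]
    by (metis A.mem_carrier compatible_def conj_closed plus_1_eq_Suc)
qed

text \<open>The extension is \<open>a \<otimes> g [^] i \<mapsto> \<phi> a \<otimes> h [^] i\<close>
  with \<open>h = c \<otimes> g\<close>. It is well defined because the condition on
  \<open>c\<close> means \<open>h [^] p = \<phi> (g [^] p)\<close>, and multiplicative because
  \<open>h\<close> and \<open>g\<close> act alike on the abelian group \<open>A\<close>.\<close>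

lemma automorphism_extension:
  assumes \<phi>: "compatible \<phi>" and c: "c \<in> A" and c_norm: "norm c = \<phi> (g [^] p) \<otimes> inv (g [^] p)"
  shows "\<exists>\<alpha>\<in>auto G. (\<forall>a\<in>A. \<alpha> a = \<phi> a) \<and> \<alpha> g = c \<otimes> g"
proof -
  interpret \<phi>: group_hom AG AG \<phi>
    by unfold_locales (use \<phi> in \<open>simp add: compatible_def\<close>)
  have \<phi>A [simp]: "\<phi> a \<in> A" if "a \<in> A" for a
    using \<phi>.hom_closed that by simp
  have \<phi>_mult: "\<phi> (a \<otimes> b) = \<phi> a \<otimes> \<phi> b" if "a \<in> A" "b \<in> A" for a b
    using \<phi>.hom_mult that by simp
  define h where "h = c \<otimes> g"
  have h [simp]: "h \<in> carrier G"
    using c g_carrier by (simp add: h_def)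
  have hp: "h [^] p = \<phi> (g [^] p)"
    using c c_norm norm_eq[OF c] g_pow_p by (simp add: h_def m_assoc)
  have wd: "\<phi> a \<otimes> h [^] i = \<phi> b \<otimes> h [^] j"
    if eq: "a \<otimes> g [^] i = b \<otimes> g [^] j" and ab: "a \<in> A" "b \<in> A" and "i \<le> j" for a b and i j :: nat
  proof -
    have "a \<otimes> g [^] i = b \<otimes> g [^] (j - i) \<otimes> g [^] i"
      using that g_carrier by (simp add: m_assoc nat_pow_mult)
    then have a: "a = b \<otimes> g [^] (j - i)"
      using ab g_carrier by simp
    then have "g [^] (j - i) = inv b \<otimes> a"
      using ab by (simp add: mult_inv_cancel)
    then have "p dvd j - i"
      using ab by (simp flip: pow_mem_iff)
    then obtain k where k: "j - i = p * k" by blast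
    have "\<phi> a = \<phi> b \<otimes> \<phi> ((g [^] p) [^] k)"
      using a ab k pow_mem_iff[of "p * k"] g_carrier by (simp add: \<phi>_mult nat_pow_pow)
    also have "\<phi> ((g [^] p) [^] k) = h [^] (j - i)"
      using \<phi>.hom_nat_pow[of "g [^] p" k] g_pow_p by (simp add: k hp nat_pow_pow flip: nat_pow_consistent)
        (metis h hp nat_pow_pow)
    finally show ?thesis
      using ab that(4) by (simp add: m_assoc nat_pow_mult)
  qed
  then have wd: "\<phi> a \<otimes> h [^] i = \<phi> b \<otimes> h [^] j"
    if "a \<otimes> g [^] i = b \<otimes> g [^] j" "a \<in> A" "b \<in> A" for a b and i j :: nat
    using that by (metis nat_le_linear)
  define \<alpha> where "\<alpha> = (\<lambda>x\<in>carrier G. SOME y. \<exists>a\<in>A. \<exists>i::nat. x = a \<otimes> g [^] i \<and> y = \<phi> a \<otimes> h [^] i)"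
  have \<alpha>: "\<alpha> (a \<otimes> g [^] i) = \<phi> a \<otimes> h [^] i" if a: "a \<in> A" for a and i :: nat
  proof -
    have "(SOME y. \<exists>b\<in>A. \<exists>j::nat. a \<otimes> g [^] i = b \<otimes> g [^] j \<and> y = \<phi> b \<otimes> h [^] j) = \<phi> a \<otimes> h [^] i"
    proof (rule some_equality)
      show "\<exists>b\<in>A. \<exists>j::nat. a \<otimes> g [^] i = b \<otimes> g [^] j \<and> \<phi> a \<otimes> h [^] i = \<phi> b \<otimes> h [^] j"
        using a by blast
    next
      fix y assume "\<exists>b\<in>A. \<exists>j::nat. a \<otimes> g [^] i = b \<otimes> g [^] j \<and> y = \<phi> b \<otimes> h [^] j"
      then obtain b and j :: nat where "b \<in> A" "a \<otimes> g [^] i = b \<otimes> g [^] j" "y = \<phi> b \<otimes> h [^] j" by blast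
      then show "y = \<phi> a \<otimes> h [^] i"
        using wd[OF _ a] by simp
    qed
    then show ?thesis using a g_carrier by (simp add: \<alpha>_def)
  qed
  have h_conj: "h [^] i \<otimes> b = conj i b \<otimes> h [^] i" if "b \<in> A" for b and i :: nat
    using that
  proof (induction i arbitrary: b)
    case (Suc i)
    have "h \<otimes> b = c \<otimes> (g [^] (1::nat) \<otimes> b)"
      using Suc.prems c g_carrier by (simp add: h_def m_assoc)
    also have "\<dots> = c \<otimes> conj 1 b \<otimes> g"
      using Suc.prems c g_carrier by (simp only: pow_mult_eq A.mem_carrier) (simp add: m_assoc)
    also have "\<dots> = conj 1 b \<otimes> h"
      using Suc.prems c g_carrier A_comm[of c "conj 1 b"] by (simp add: h_def m_assoc)
    finally have "h [^] Suc i \<otimes> b = h [^] i \<otimes> conj 1 b \<otimes> h"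
      using Suc.prems by (simp add: m_assoc)
    also have "\<dots> = conj i (conj 1 b) \<otimes> h [^] i \<otimes> h"
      using Suc by simp
    finally show ?case
      using Suc.prems by (simp add: conj_conj m_assoc)
  qed simp
  have \<alpha>_hom: "\<alpha> \<in> hom G G"
  proof (rule homI)
    fix x assume "x \<in> carrier G"
    then show "\<alpha> x \<in> carrier G"
      using generated \<alpha> by fastforce
  next
    fix x y assume "x \<in> carrier G" "y \<in> carrier G"
    then obtain a b and i j :: nat where x: "x = a \<otimes> g [^] i" "a \<in> A" and y: "y = b \<otimes> g [^] j" "b \<in> A"
      using generated by meson
    have "x \<otimes> y = a \<otimes> (g [^] i \<otimes> b) \<otimes> g [^] j"
      using x y by (simp add: m_assoc)
    also have "\<dots> = (a \<otimes> conj i b) \<otimes> g [^] (i + j)"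
      using x y g_carrier by (simp add: pow_mult_eq m_assoc nat_pow_mult)
    finally have xy: "x \<otimes> y = (a \<otimes> conj i b) \<otimes> g [^] (i + j)" .
    have "\<alpha> (x \<otimes> y) = \<phi> (a \<otimes> conj i b) \<otimes> h [^] (i + j)"
      unfolding xy using x y by (intro \<alpha>) simp
    also have "\<dots> = \<phi> a \<otimes> (conj i (\<phi> b) \<otimes> h [^] i) \<otimes> h [^] j"
      using x y by (simp add: \<phi>_mult compatible_conj[OF \<phi>] m_assoc nat_pow_mult)
    also have "\<dots> = \<alpha> x \<otimes> \<alpha> y"
      using x y by (simp add: \<alpha> m_assoc flip: h_conj)
    finally show "\<alpha> (x \<otimes> y) = \<alpha> x \<otimes> \<alpha> y" .
  qed
  interpret \<alpha>: group_hom G G \<alpha>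
    by unfold_locales (rule \<alpha>_hom)
  have \<alpha>A: "\<alpha> a = \<phi> a" if "a \<in> A" for a
    using \<alpha>[OF that, of 0] that by simp
  have \<alpha>g: "\<alpha> g = h"
    using \<alpha>[OF A.one_closed, of 1] \<phi>.hom_one g_carrier by simp
  have img: "subgroup (\<alpha> ` carrier G) G"
    by (rule \<alpha>.img_is_subgroup)
  \<comment> \<open>An injective endomorphism of the finite group \<open>A\<close> is onto. The
    image of \<open>\<alpha>\<close> thus contains \<open>A\<close> and \<open>h\<close>, hence
    \<open>g\<close>, hence all of \<open>G\<close>; finiteness then makes \<open>\<alpha>\<close>
    bijective.\<close>
  have "\<phi> ` A = A"
    using \<phi> finite_A by (intro endo_inj_surj) (auto simp: compatible_def)
  then have A_img: "A \<subseteq> \<alpha> ` carrier G"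
    using \<alpha>A A.subset by (metis image_cong image_mono)
  have "inv c \<otimes> h \<in> \<alpha> ` carrier G"
    using A_img c \<alpha>g g_carrier by (intro subgroup.m_closed[OF img]) auto
  then have g_img: "g \<in> \<alpha> ` carrier G"
    using c g_carrier by (simp add: h_def mult_inv_cancel)
  have "carrier G \<subseteq> \<alpha> ` carrier G"
  proof
    fix x assume "x \<in> carrier G"
    then obtain a and i :: nat where x: "x = a \<otimes> g [^] i" "a \<in> A"
      using generated by blast
    have "g [^] i \<in> \<alpha> ` carrier G"
      using subgroup_int_pow_closed[OF img g_img, of "int i"] by (simp add: int_pow_int)
    then show "x \<in> \<alpha> ` carrier G"
      using x A_img subgroup.m_closed[OF img] by blast
  qed
  then have "bij_betw \<alpha> (carrier G) (carrier G)"
    using finite_surj_inj[OF finite_carrier] by (auto simp: bij_betw_def)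
  then have "\<alpha> \<in> auto G"
    using \<alpha>_hom by (auto simp: auto_def Bij_def \<alpha>_def)
  then show ?thesis
    using \<alpha>A \<alpha>g h_def by blast
qed

text \<open>Automorphisms that restrict to a member of \<open>R\<close> and act trivially on
  \<open>G/A\<close> correspond to pairs of \<open>\<phi>\<close> in \<open>R\<close> and a solution
  \<open>c\<close> of the norm equation. For each \<open>\<phi>\<close> the solutions form a coset
  of the kernel of the norm. These automorphisms are closed under composition, so their number
  divides the order of the automorphism group.\<close>

lemma card_compatible_dvd:
  assumes compat: "\<And>\<phi>. \<phi> \<in> R \<Longrightarrow> compatible \<phi>" and "R \<noteq> {}"
    and closed: "\<And>\<phi> \<psi>. \<lbrakk>\<phi> \<in> R; \<psi> \<in> R\<rbrakk> \<Longrightarrow> compose A \<phi> \<psi> \<in> R"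
  shows "card R * card (kernel AG AG norm) dvd order (AutoGroup G)"
proof -
  define P where "P = {\<alpha> \<in> auto G. restrict \<alpha> A \<in> R \<and> \<alpha> g \<otimes> inv g \<in> A}"
  define T where "T = (SIGMA \<phi>:R. {c \<in> A. norm c = \<phi> (g [^] p) \<otimes> inv (g [^] p)})"
  have RA: "\<phi> a \<in> A" if "\<phi> \<in> R" "a \<in> A" for \<phi> a
    using compat[OF that(1)] that(2) by (auto simp: compatible_def hom_def)
  have PA: "\<alpha> a \<in> A" if "\<alpha> \<in> P" "a \<in> A" for \<alpha> a
    using that RA[of "restrict \<alpha> A" a] by (simp add: P_def)
  have hom: "group_hom G G \<alpha>" if "\<alpha> \<in> P" for \<alpha>
    using that by unfold_locales (simp add: P_def auto_def)
  have fibre: "card {c \<in> A. norm c = \<phi> (g [^] p) \<otimes> inv (g [^] p)} = card (kernel AG AG norm)"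
    "{c \<in> A. norm c = \<phi> (g [^] p) \<otimes> inv (g [^] p)} \<noteq> {}" if \<phi>: "\<phi> \<in> R" for \<phi>
  proof -
    obtain c where c: "c \<in> A" "norm c = \<phi> (g [^] p) \<otimes> inv (g [^] p)"
      using compat[OF \<phi>] by (auto simp: compatible_def C_def)
    then show "{c \<in> A. norm c = \<phi> (g [^] p) \<otimes> inv (g [^] p)} \<noteq> {}" by blast
    show "card {c \<in> A. norm c = \<phi> (g [^] p) \<otimes> inv (g [^] p)} = card (kernel AG AG norm)"
      using norm.card_fibre[of c] c by simp
  qed
  have "bij_betw (\<lambda>\<alpha>. (restrict \<alpha> A, \<alpha> g \<otimes> inv g)) P T"
    unfolding bij_betw_def
  proof
    show "inj_on (\<lambda>\<alpha>. (restrict \<alpha> A, \<alpha> g \<otimes> inv g)) P"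
    proof (rule inj_onI)
      fix \<alpha> \<beta> assume \<alpha>: "\<alpha> \<in> P" and \<beta>: "\<beta> \<in> P"
        and eq: "(restrict \<alpha> A, \<alpha> g \<otimes> inv g) = (restrict \<beta> A, \<beta> g \<otimes> inv g)"
      interpret \<alpha>: group_hom G G \<alpha> by (rule hom[OF \<alpha>])
      interpret \<beta>: group_hom G G \<beta> by (rule hom[OF \<beta>])
      have A_eq: "\<alpha> a = \<beta> a" if "a \<in> A" for a
        using eq that by (metis Pair_inject restrict_apply')
      have g_eq: "\<alpha> g = \<beta> g"
        using eq g_carrier by simp
      show "\<alpha> = \<beta>"
      proof (rule extensionalityI)
        show "\<alpha> \<in> extensional (carrier G)" "\<beta> \<in> extensional (carrier G)"
          using \<alpha> \<beta> by (auto simp: P_def auto_def Bij_def)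
        fix x assume "x \<in> carrier G"
        then obtain a and i :: nat where x: "x = a \<otimes> g [^] i" "a \<in> A"
          using generated by blast
        then show "\<alpha> x = \<beta> x"
          using A_eq g_eq g_carrier by (simp add: \<alpha>.hom_nat_pow \<beta>.hom_nat_pow)
      qed
    qed
    show "(\<lambda>\<alpha>. (restrict \<alpha> A, \<alpha> g \<otimes> inv g)) ` P = T"
    proof
      show "(\<lambda>\<alpha>. (restrict \<alpha> A, \<alpha> g \<otimes> inv g)) ` P \<subseteq> T"
      proof
        fix t assume "t \<in> (\<lambda>\<alpha>. (restrict \<alpha> A, \<alpha> g \<otimes> inv g)) ` P"
        then obtain \<alpha> where \<alpha>: "\<alpha> \<in> P" and t: "t = (restrict \<alpha> A, \<alpha> g \<otimes> inv g)" by blast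
        interpret \<alpha>: group_hom G G \<alpha> by (rule hom[OF \<alpha>])
        define c where "c = \<alpha> g \<otimes> inv g"
        have c: "c \<in> A" "\<alpha> g = c \<otimes> g"
          using \<alpha> g_carrier by (auto simp: c_def P_def m_assoc)
        have "norm c \<otimes> g [^] p = \<alpha> (g [^] p)"
          using norm_eq[OF c(1)] c g_carrier by (simp add: \<alpha>.hom_nat_pow)
        then have "norm c = \<alpha> (g [^] p) \<otimes> inv (g [^] p)"
          using c by (metis A.mem_carrier \<alpha>.hom_closed g_pow inv_solve_right norm_closed)
        then show "t \<in> T"
          using \<alpha> c(1) g_pow_p unfolding t c_def[symmetric] by (simp add: T_def P_def)
      qed
      show "T \<subseteq> (\<lambda>\<alpha>. (restrict \<alpha> A, \<alpha> g \<otimes> inv g)) ` P"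
      proof
        fix t assume "t \<in> T"
        then obtain \<phi> c where t: "t = (\<phi>, c)" "\<phi> \<in> R" "c \<in> A"
          "norm c = \<phi> (g [^] p) \<otimes> inv (g [^] p)"
          by (auto simp: T_def)
        then obtain \<alpha> where \<alpha>: "\<alpha> \<in> auto G" "\<And>a. a \<in> A \<Longrightarrow> \<alpha> a = \<phi> a" "\<alpha> g = c \<otimes> g"
          using automorphism_extension[OF compat[OF t(2)] t(3,4)] by blast
        have "restrict \<alpha> A = \<phi>"
          using \<alpha>(2) compat[OF t(2)]
          by (intro extensionalityI[of _ A]) (auto simp: compatible_def)
        moreover have "\<alpha> g \<otimes> inv g = c"
          using \<alpha>(3) t g_carrier by (simp add: m_assoc)
        ultimately show "t \<in> (\<lambda>\<alpha>. (restrict \<alpha> A, \<alpha> g \<otimes> inv g)) ` P"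
          using t \<alpha> by (auto simp: P_def image_iff intro!: bexI[of _ \<alpha>])
      qed
    qed
  qed
  then have "card P = card T" and img: "(\<lambda>\<alpha>. (restrict \<alpha> A, \<alpha> g \<otimes> inv g)) ` P = T"
    by (rule bij_betw_same_card, rule bij_betw_imp_surj_on)
  moreover have "card T = card R * card (kernel AG AG norm)"
  proof -
    have "R \<subseteq> A \<rightarrow>\<^sub>E A"
      using compat RA by (auto simp: compatible_def PiE_def)
    then have "finite R"
      using finite_A by (meson finite_PiE finite_subset)
    then show ?thesis
      using finite_A fibre(1) by (simp add: T_def)
  qed
  moreover have "card P dvd order (AutoGroup G)"
  proof (rule order_AutoGroup_dvdI[OF finite_carrier])
    show "P \<subseteq> auto G" by (auto simp: P_def)
    show "P \<noteq> {}"
    proof -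
      have "T \<noteq> {}"
        using fibre(2) assms(2) by (auto simp: T_def)
      then show ?thesis using img by blast
    qed
    fix \<alpha> \<beta> assume \<alpha>: "\<alpha> \<in> P" and \<beta>: "\<beta> \<in> P"
    interpret \<alpha>: group_hom G G \<alpha> by (rule hom[OF \<alpha>])
    have "compose (carrier G) \<alpha> \<beta> \<in> auto G"
      using \<alpha> \<beta> by (auto simp: P_def auto_def compose_Bij hom_compose)
    moreover have "restrict (compose (carrier G) \<alpha> \<beta>) A = compose A (restrict \<alpha> A) (restrict \<beta> A)"
      using PA[OF \<beta>] by (auto simp: compose_def restrict_def)
    then have "restrict (compose (carrier G) \<alpha> \<beta>) A \<in> R"
      using closed \<alpha> \<beta> by (simp add: P_def)
    moreover have "compose (carrier G) \<alpha> \<beta> g \<otimes> inv g \<in> A"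
    proof -
      define b c where "b = \<beta> g \<otimes> inv g" and "c = \<alpha> g \<otimes> inv g"
      interpret \<beta>: group_hom G G \<beta> by (rule hom[OF \<beta>])
      have "b \<in> A" "c \<in> A" "\<beta> g = b \<otimes> g" "\<alpha> g = c \<otimes> g"
        using \<alpha> \<beta> g_carrier by (auto simp: b_def c_def P_def m_assoc)
      then have "compose (carrier G) \<alpha> \<beta> g \<otimes> inv g = \<alpha> b \<otimes> c"
        using g_carrier PA[OF \<alpha>, of b] by (simp add: compose_def m_assoc)
      then show ?thesis
        using PA[OF \<alpha> \<open>b \<in> A\<close>] \<open>c \<in> A\<close> by simp
    qed
    ultimately show "compose (carrier G) \<alpha> \<beta> \<in> P"
      by (simp add: P_def)
  qed
  ultimately show ?thesis by simp
qed

lemma order_dvd_order_AutoGroupI: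
  assumes "\<And>\<phi>. \<phi> \<in> R \<Longrightarrow> compatible \<phi>" and "R \<noteq> {}"
    and "\<And>\<phi> \<psi>. \<lbrakk>\<phi> \<in> R; \<psi> \<in> R\<rbrakk> \<Longrightarrow> compose A \<phi> \<psi> \<in> R"
    and "p * card C dvd card R"
  shows "order G dvd order (AutoGroup G)"
proof -
  have "order G = p * card C * card (kernel AG AG norm)"
    by (simp add: card_A card_A_norm)
  also have "\<dots> dvd card R * card (kernel AG AG norm)"
    using assms(4) by (rule mult_dvd_mono) simp
  also have "\<dots> dvd order (AutoGroup G)"
    using card_compatible_dvd assms(1-3) by blast
  finally show ?thesis .
qed

end

section \<open>Automorphisms from homomorphisms\<close>

lemma (in group) card_subgroup_prime_power:
  assumes "Factorial_Ring.prime p" "order G = p ^ n" "subgroup K G"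
  shows "\<exists>m. card K = p ^ m"
proof -
  have "card K dvd p ^ n"
    using lagrange[OF assms(3)] assms(2) by (metis dvd_triv_right)
  then show ?thesis
    using divides_primepow_nat[OF assms(1)] by blast
qed

context cyclic_extension
begin

lemma conj_mult_p: "a \<in> A \<Longrightarrow> conj (p * k + i) a = conj i a"
proof (induction k)
  case (Suc k)
  have "conj (p * Suc k + i) a = conj p (conj (p * k + i) a)"
    using Suc.prems by (simp add: conj_conj add_ac)
  then show ?case
    using Suc by (simp add: conj_of_pow)
qed simp

lemma AG_pow: "x [^]\<^bsub>G\<lparr>carrier := K\<rparr>\<^esub> (k::nat) = x [^] k"
  by (metis nat_pow_consistent)

lemma AG_int_pow: "x \<in> A \<Longrightarrow> x [^]\<^bsub>AG\<^esub> (k::int) = x [^] k"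
  using int_pow_consistent[OF A_subgroup] by simp

lemma int_pow_mem [simp]: "x \<in> A \<Longrightarrow> x [^] (k::int) \<in> A"
  by (rule subgroup_int_pow_closed[OF A_subgroup])

lemma subgroup_AG: "subgroup K G \<Longrightarrow> K \<subseteq> A \<Longrightarrow> subgroup K AG"
  by (rule subgroup_incl[OF _ A_subgroup])

lemma carrier_hom_group_iff:
  "\<psi> \<in> carrier (hom_group AG E (G\<lparr>carrier := K\<rparr>)) \<longleftrightarrow>
    \<psi> \<in> extensional A \<and> (\<forall>x\<in>A. \<psi> x \<in> K) \<and> (\<forall>x\<in>A. \<forall>y\<in>A. \<psi> (x \<otimes> y) = \<psi> x \<otimes> \<psi> y) \<and>
    (\<forall>d\<in>E. \<psi> d = \<one>)"
  by (auto simp: hom_group_def hom_def)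

end

text \<open>The endomorphisms \<open>x \<mapsto> g\<^sup>i x g\<^sup>-\<^sup>i \<psi>(x)\<close> of \<open>A\<close>, for homomorphisms \<open>\<psi> : A/E \<rightarrow> K\<close>.\<close>
locale twisted_homs = cyclic_extension +
  fixes E K :: "'a set"
  assumes E: "subgroup E G" "D \<subseteq> E" "E \<subseteq> A"
    and K: "subgroup K G" "K \<subseteq> A"
    and K_fixed: "\<And>c. c \<in> K \<Longrightarrow> conj 1 c = c"
    and no_fixed_point: "\<And>\<psi> x. \<lbrakk>\<psi> \<in> carrier (hom_group AG E (G\<lparr>carrier := K\<rparr>)); x \<in> A; \<psi> x = inv x\<rbrakk>
      \<Longrightarrow> x = \<one>"
    and power_image: "\<And>\<psi>. \<psi> \<in> carrier (hom_group AG E (G\<lparr>carrier := K\<rparr>)) \<Longrightarrow> \<psi> (g [^] p) \<in> C"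
begin

abbreviation H where "H \<equiv> carrier (hom_group AG E (G\<lparr>carrier := K\<rparr>))"

definition twist :: "nat \<Rightarrow> ('a \<Rightarrow> 'a) \<Rightarrow> 'a \<Rightarrow> 'a"
  where "twist i \<psi> = (\<lambda>x\<in>A. conj i x \<otimes> \<psi> x)"

lemma H_simps:
  assumes "\<psi> \<in> H"
  shows "x \<in> A \<Longrightarrow> \<psi> x \<in> K" "x \<in> A \<Longrightarrow> \<psi> x \<in> A" "x \<in> A \<Longrightarrow> y \<in> A \<Longrightarrow> \<psi> (x \<otimes> y) = \<psi> x \<otimes> \<psi> y"
    "d \<in> E \<Longrightarrow> \<psi> d = \<one>" "x \<in> A \<Longrightarrow> \<psi> (conj i x) = \<psi> x" "\<psi> \<in> extensional A"
proof -
  show *: "x \<in> A \<Longrightarrow> \<psi> x \<in> K" "x \<in> A \<Longrightarrow> \<psi> x \<in> A" "x \<in> A \<Longrightarrow> y \<in> A \<Longrightarrow> \<psi> (x \<otimes> y) = \<psi> x \<otimes> \<psi> y"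
    "d \<in> E \<Longrightarrow> \<psi> d = \<one>" "\<psi> \<in> extensional A" for x y d
    using assms K(2) by (auto simp: carrier_hom_group_iff)
  show "\<psi> (conj i x) = \<psi> x" if x: "x \<in> A"
  proof -
    have "\<psi> (conj i x) = \<psi> (conj i x \<otimes> inv x \<otimes> x)"
      using x by (simp add: m_assoc)
    also have "\<dots> = \<psi> (conj i x \<otimes> inv x) \<otimes> \<psi> x"
      using x by (intro *) auto
    \<comment> \<open>Invariance under \<open>conj i\<close> comes from \<open>D\<close> being
      contained in \<open>E\<close>, which \<open>\<psi>\<close> kills.\<close>
    also have "\<psi> (conj i x \<otimes> inv x) = \<one>"
      using conj_mod_D[OF x] E(2) * by blast
    finally show ?thesis
      using *(2)[OF x] by simp
  qed
qed

lemma K_conj: "c \<in> K \<Longrightarrow> conj i c = c"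
proof (induction i)
  case (Suc i)
  then show ?case
    using K_fixed[of c] K(2) conj_conj[of c 1 i] by auto
qed (use K(2) in auto)

text \<open>A kernel element \<open>x\<close> gives
  \<open>\<psi> (conj i x) = inv (conj i x)\<close>, which \<open>no_fixed_point\<close> excludes
  unless \<open>x\<close> is trivial. The map commutes with \<open>g\<close> because
  \<open>K\<close> is fixed by \<open>g\<close> and \<open>\<psi>\<close> is invariant under it. It
  multiplies \<open>g [^] p\<close> by \<open>\<psi> (g [^] p)\<close>.\<close>

lemma compatible_twist:
  assumes \<psi>: "\<psi> \<in> H"
  shows "compatible (twist i \<psi>)"
proof -
  note [simp] = H_simps[OF \<psi>]
  have hom: "twist i \<psi> \<in> hom AG AG"
    by (rule homI) (simp_all add: twist_def conj_mult A_ac)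
  then interpret h: group_hom AG AG "twist i \<psi>"
    by unfold_locales
  have "x = \<one>" if x: "x \<in> A" "twist i \<psi> x = \<one>" for x
  proof -
    have "conj i x = inv (\<psi> x)"
      using x by (intro inv_equality[symmetric]) (simp_all add: twist_def)
    moreover have "\<psi> (conj i x) = \<psi> x"
      using x by simp
    ultimately have "conj i x = inv (\<psi> (conj i x))"
      by (simp only:)
    then have "\<psi> (conj i x) = inv (conj i x)"
      using x by (metis A.mem_carrier H_simps(2)[OF \<psi>] conj_closed inv_inv)
    then have "conj i x = \<one>"
      using x by (intro no_fixed_point[OF \<psi>]) simp_all
    \<comment> \<open>Since \<open>i\<close> may exceed \<open>p\<close>, the exponent
      \<open>p * i - i\<close> is used to undo \<open>conj i\<close>.\<close>
    moreover have "conj (p * i - i) (conj i x) = x"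
      using x prime_gt_0_nat[OF prime_p] conj_mult_p[of x i 0] by (simp add: conj_conj)
    ultimately show "x = \<one>"
      by (simp add: conj_def)
  qed
  then have "inj_on (twist i \<psi>) A"
    using h.inj_on_one_iff by simp
  moreover have "twist i \<psi> (conj 1 a) = conj 1 (twist i \<psi> a)" if "a \<in> A" for a
    using that by (simp add: twist_def conj_mult conj_conj K_conj del: One_nat_def) (simp add: add.commute)
  moreover have "twist i \<psi> (g [^] p) \<otimes> inv (g [^] p) \<in> C"
  proof -
    have "conj i (g [^] p) = g [^] p"
    proof -
      have "g [^] i \<otimes> g [^] p = g [^] p \<otimes> g [^] i"
        using g_carrier by (simp add: nat_pow_mult add.commute)
      then show ?thesis by (simp add: conj_def m_assoc)
    qed
    then have "twist i \<psi> (g [^] p) \<otimes> inv (g [^] p) = \<psi> (g [^] p)"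
      using g_pow_p A_comm[of "g [^] p" "\<psi> (g [^] p)"] by (simp add: twist_def m_assoc)
    then show ?thesis using power_image[OF \<psi>] by simp
  qed
  ultimately show ?thesis
    using hom by (simp add: compatible_def twist_def)
qed

lemma compose_twist:
  assumes \<psi>: "\<psi> \<in> H" and \<chi>: "\<chi> \<in> H"
  shows "\<exists>\<omega>\<in>H. compose A (twist i \<psi>) (twist j \<chi>) = twist (i + j) \<omega>"
proof
  \<comment> \<open>This comes from expanding \<open>conj i y \<otimes> \<psi> y\<close> at
    \<open>y = conj j x \<otimes> \<chi> x\<close>; the conjugations disappear inside
    \<open>\<psi>\<close> and on \<open>K\<close>.\<close>
  let ?\<omega> = "\<lambda>x\<in>A. \<psi> x \<otimes> \<chi> x \<otimes> \<psi> (\<chi> x)"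
  note [simp] = H_simps[OF \<psi>] H_simps[OF \<chi>]
  have \<psi>_one: "\<psi> \<one> = \<one>"
    using E(1) by (simp add: subgroup.one_closed)
  show "?\<omega> \<in> H"
    using subsetD[OF E(3)] \<psi>_one by (auto simp: carrier_hom_group_iff A_ac subgroup.m_closed[OF K(1)])
  show "compose A (twist i \<psi>) (twist j \<chi>) = twist (i + j) ?\<omega>"
  proof (rule extensionalityI[of _ A])
    fix x assume "x \<in> A"
    then show "compose A (twist i \<psi>) (twist j \<chi>) x = twist (i + j) ?\<omega> x"
      by (simp add: compose_def twist_def conj_mult conj_conj K_conj A_ac)
  qed (simp_all add: twist_def)
qed

lemma H_nonempty: "H \<noteq> {}"
proof -
  have "(\<lambda>x\<in>A. \<one>) \<in> H"
    using E(3) subgroup.one_closed[OF K(1)] by (auto simp: carrier_hom_group_iff)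
  then show ?thesis by blast
qed

lemma order_dvd_of_hom:
  assumes "p * card C dvd card H"
  shows "order G dvd order (AutoGroup G)"
proof (rule order_dvd_order_AutoGroupI[where R = "twist 0 ` H"])
  have "inj_on (twist 0) H"
  proof (rule inj_onI)
    fix \<psi> \<chi> assume \<psi>: "\<psi> \<in> H" and \<chi>: "\<chi> \<in> H" and eq: "twist 0 \<psi> = twist 0 \<chi>"
    show "\<psi> = \<chi>"
    proof (rule extensionalityI[of _ A])
      fix x assume x: "x \<in> A"
      then have "x \<otimes> \<psi> x = x \<otimes> \<chi> x"
        using fun_cong[OF eq, of x] by (simp add: twist_def)
      then show "\<psi> x = \<chi> x"
        using x H_simps(2)[OF \<psi>] H_simps(2)[OF \<chi>] by simp
    qed (use \<psi> \<chi> in \<open>auto simp: H_simps\<close>)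
  qed
  then show "p * card C dvd card (twist 0 ` H)"
    using assms by (simp add: card_image)
next
  fix \<phi> \<psi> assume "\<phi> \<in> twist 0 ` H" "\<psi> \<in> twist 0 ` H"
  then show "compose A \<phi> \<psi> \<in> twist 0 ` H"
    using compose_twist[where i = 0 and j = 0] by fastforce
qed (use compatible_twist H_nonempty in auto)

text \<open>If twists with exponents different modulo \<open>p\<close> coincided, some power of
  \<open>g\<close> outside \<open>A\<close> would act trivially on \<open>A\<close> modulo
  \<open>K\<close>. Then so would \<open>g\<close>, which means that \<open>D\<close> is contained
  in \<open>K\<close>. The exponents therefore contribute a factor \<open>p\<close> beyond
  \<open>card H\<close>.\<close>

lemma order_dvd_of_not_subset:
  assumes "\<not> D \<subseteq> K" "card C dvd card H"
  shows "order G dvd order (AutoGroup G)"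
proof (rule order_dvd_order_AutoGroupI[where R = "(\<lambda>(i, \<psi>). twist i \<psi>) ` (UNIV \<times> H)"])
  have "inj_on (\<lambda>(i, \<psi>). twist i \<psi>) ({..<p} \<times> H)"
  proof (rule inj_onI)
    fix u v assume u: "u \<in> {..<p} \<times> H" and v: "v \<in> {..<p} \<times> H"
      and eq: "(case u of (i, \<psi>) \<Rightarrow> twist i \<psi>) = (case v of (i, \<psi>) \<Rightarrow> twist i \<psi>)"
    obtain i \<psi> j \<chi> where uv: "u = (i, \<psi>)" "v = (j, \<chi>)" by (cases u, cases v) auto
    have False
      if ij: "i < j" "j < p" and \<psi>: "\<psi> \<in> H" and \<chi>: "\<chi> \<in> H" and eq: "twist i \<psi> = twist j \<chi>" for i j \<psi> \<chi>
    proof -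
      define k where "k = j - i"
      have k: "conj k y \<otimes> inv y \<in> K" if y: "y \<in> A" for y
      proof -
        \<comment> \<open>This choice cancels \<open>conj i\<close>, so comparing the two twists at
          \<open>x\<close> compares \<open>y\<close> with \<open>conj k y\<close>.\<close>
        define x where "x = conj (p - i) y"
        have x: "x \<in> A" "conj i x = y" "conj j x = conj k y"
        proof -
          show "x \<in> A" using y by (simp add: x_def)
          show "conj i x = y"
            using y ij conj_mult_p[of y 1 0] by (simp add: x_def conj_conj)
          have "j + (p - i) = p * 1 + k" using ij by (simp add: k_def)
          then show "conj j x = conj k y"
            using y conj_mult_p[of y 1 k] by (simp add: x_def conj_conj)
        qed
        have "y \<otimes> \<psi> x = conj k y \<otimes> \<chi> x"
          using fun_cong[OF eq, of x] x by (simp add: twist_def)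
        then have "conj k y = y \<otimes> \<psi> x \<otimes> inv (\<chi> x)"
          using x y H_simps(2)[OF \<psi>] H_simps(2)[OF \<chi>] by (simp add: inv_solve_right)
        then have "conj k y \<otimes> inv y = \<psi> x \<otimes> inv (\<chi> x)"
          using x y H_simps(2)[OF \<psi>] H_simps(2)[OF \<chi>] A_comm[of y "\<psi> x \<otimes> inv (\<chi> x)"]
          by (simp add: m_assoc)
        then show ?thesis
          using x H_simps(1)[OF \<psi>] H_simps(1)[OF \<chi>] K(1) by (simp add: subgroupE)
      qed
      have km: "conj (k * m) y \<otimes> inv y \<in> K" if y: "y \<in> A" for m y
      proof (induction m)
        case 0
        then show ?case using y K(1) by (simp add: subgroup.one_closed)
      next
        case (Suc m)
        have "(conj k (conj (k * m) y) \<otimes> inv (conj (k * m) y)) \<otimes> (conj (k * m) y \<otimes> inv y) \<in> K"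
          by (rule subgroup.m_closed[OF K(1) k[OF conj_closed[OF y]] Suc])
        then show ?case
          using y by (simp add: group_normalize conj_conj)
      qed
      have "k \<noteq> 0" "\<not> p dvd k"
        using ij by (auto simp: k_def dest: dvd_imp_le)
      then have "gcd k p = 1"
        using prime_p by (metis coprime_imp_gcd_eq_1 coprime_commute prime_imp_coprime)
      \<comment> \<open>As \<open>k\<close> is invertible modulo \<open>p\<close>, iterating
        \<open>conj k\<close> yields \<open>conj 1\<close>.\<close>
      then obtain m q where "k * m = p * q + 1"
        using bezout_nat[OF \<open>k \<noteq> 0\<close>, of p] by auto
      then have "conj 1 y \<otimes> inv y \<in> K" if "y \<in> A" for y
        using km[OF that, of m] that by (simp only: conj_mult_p)
      then show False
        using assms(1) by (auto simp: D_def)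
    qed
    note False_if = this
    have "i = j"
      using False_if[of i j \<psi> \<chi>] False_if[of j i \<chi> \<psi>] u v uv eq by (cases i j rule: linorder_cases) auto
    moreover have "\<psi> x = \<chi> x" if x: "x \<in> A" for x
    proof -
      have "conj i x \<otimes> \<psi> x = conj i x \<otimes> \<chi> x"
        using eq uv x \<open>i = j\<close> by (auto simp: twist_def dest!: fun_cong[of _ _ x])
      then show ?thesis
        using x u v uv H_simps(2)[of \<psi> x] H_simps(2)[of \<chi> x] by simp
    qed
    ultimately show "u = v"
      using u v uv H_simps(6)[of \<psi>] H_simps(6)[of \<chi>] by (auto intro!: extensionalityI[of _ A])
  qed
  \<comment> \<open>Arbitrary exponents make closure under composition immediate; only their
    residues modulo \<open>p\<close> enter the count.\<close>
  moreover have "(\<lambda>(i, \<psi>). twist i \<psi>) ` (UNIV \<times> H) = (\<lambda>(i, \<psi>). twist i \<psi>) ` ({..<p} \<times> H)"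
  proof -
    have "twist i \<psi> = twist (i mod p) \<psi>" for i \<psi>
      using conj_mult_p[of _ "i div p" "i mod p"] by (auto simp: twist_def)
    moreover have "i mod p < p" for i
      using prime_gt_0_nat[OF prime_p] by simp
    ultimately show ?thesis
      by (fastforce simp: image_iff)
  qed
  ultimately show "p * card C dvd card ((\<lambda>(i, \<psi>). twist i \<psi>) ` (UNIV \<times> H))"
    using assms(2) by (simp add: card_image card_cartesian_product)
next
  fix \<phi> \<psi>
  assume \<phi>: "\<phi> \<in> (\<lambda>(i, \<psi>). twist i \<psi>) ` (UNIV \<times> H)" and \<psi>: "\<psi> \<in> (\<lambda>(i, \<psi>). twist i \<psi>) ` (UNIV \<times> H)"
  show "compose A \<phi> \<psi> \<in> (\<lambda>(i, \<psi>). twist i \<psi>) ` (UNIV \<times> H)"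
  proof -
    obtain i \<psi>' j \<chi>' where "\<phi> = twist i \<psi>'" "\<psi>' \<in> H" "\<psi> = twist j \<chi>'" "\<chi>' \<in> H"
      using \<phi> \<psi> by auto
    moreover from this obtain \<omega> where "\<omega> \<in> H" "compose A (twist i \<psi>') (twist j \<chi>') = twist (i + j) \<omega>"
      using compose_twist by blast
    ultimately show ?thesis by auto
  qed
qed (use compatible_twist H_nonempty in auto)

end

section \<open>The cases where \<open>D\<close> is not inside \<open>C\<close> or \<open>A/D\<close>
  is not cyclic\<close>

context cyclic_extension
begin

lemma order_A: "\<exists>m. order AG = p ^ m"
  using card_subgroup_prime_power[OF prime_p order_eq A_subgroup] by (simp add: order_def)

lemma card_dvd_hom:
  assumes K: "subgroup K G" "K \<subseteq> A" and E: "subgroup E G" "E \<subseteq> A"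
    and exp: "\<And>e c. (\<And>y. y \<in> A \<Longrightarrow> y [^] (p ^ e :: nat) \<in> E) \<Longrightarrow> c \<in> K \<Longrightarrow> c [^] (p ^ e :: nat) = \<one>"
  shows "card K dvd card (carrier (hom_group AG E (G\<lparr>carrier := K\<rparr>)))"
    and "\<lbrakk>\<And>x. x \<in> A \<Longrightarrow> A \<noteq> {x [^] (i::int) \<otimes> k | i k. k \<in> E}; K \<noteq> {\<one>}\<rbrakk>
      \<Longrightarrow> p * card K dvd card (carrier (hom_group AG E (G\<lparr>carrier := K\<rparr>)))"
proof -
  obtain a m where am: "order AG = p ^ a" "card K = p ^ m"
    using order_A card_subgroup_prime_power[OF prime_p order_eq K(1)] by blast
  have fin: "finite (carrier AG)"
    using finite_A by simp
  have oK: "order (G\<lparr>carrier := K\<rparr>) = p ^ m"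
    using am by (simp add: order_def)
  have exp': "c [^]\<^bsub>G\<lparr>carrier := K\<rparr>\<^esub> (p ^ e) = \<one>\<^bsub>G\<lparr>carrier := K\<rparr>\<^esub>"
    if "\<And>y. y \<in> carrier AG \<Longrightarrow> y [^]\<^bsub>AG\<^esub> (p ^ e) \<in> E" "c \<in> carrier (G\<lparr>carrier := K\<rparr>)" for e c
    using exp[of e c] that by (simp add: AG_pow)
  note * = AG.card_dvd_card_hom_group[OF fin prime_p am(1) subgroup_AG[OF E] comm_group_sub[OF K] oK exp']
  show "card K dvd card (carrier (hom_group AG E (G\<lparr>carrier := K\<rparr>)))"
    using *(1) by (simp add: order_def)
  assume noncyc: "\<And>x. x \<in> A \<Longrightarrow> A \<noteq> {x [^] (i::int) \<otimes> k | i k. k \<in> E}" and "K \<noteq> {\<one>}"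
  then have "m \<noteq> 0"
    using am K(1) by (auto simp: card_1_singleton_iff dest: subgroup.one_closed)
  moreover have "carrier AG \<noteq> {x [^]\<^bsub>AG\<^esub> (i::int) \<otimes>\<^bsub>AG\<^esub> k | i k. k \<in> E}" if "x \<in> carrier AG" for x
    using noncyc[of x] that by (simp add: AG_int_pow)
  ultimately show "p * card K dvd card (carrier (hom_group AG E (G\<lparr>carrier := K\<rparr>)))"
    using *(2) by (simp add: order_def)
qed

text \<open>The norm kills \<open>D\<close>, so \<open>C\<close> is an image of \<open>A/D\<close>
  and inherits its exponent.\<close>

lemma pow_C_trivial:
  assumes "\<And>y. y \<in> A \<Longrightarrow> y [^] (p ^ e :: nat) \<in> D" "c \<in> C"
  shows "c [^] (p ^ e :: nat) = \<one>"
proof -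
  obtain y where y: "y \<in> A" "c = norm y"
    using assms(2) by (auto simp: C_def)
  then have "c [^] (p ^ e) = norm (y [^] (p ^ e))"
    using norm.hom_nat_pow[of y "p ^ e"] by (simp add: AG_pow)
  then show ?thesis
    using norm_D assms(1) y by simp
qed

text \<open>Since \<open>N(u) \<equiv> u\<^sup>p\<close> modulo \<open>D\<close>, a homomorphism \<open>\<psi> : A/D \<rightarrow> C\<close> maps \<open>N(u)\<close> to the \<open>p\<close>-th power of
  \<open>\<psi>(u) \<in> C\<close>; so it is nilpotent on \<open>C\<close>.\<close>
lemma hom_nilpotent:
  assumes \<psi>: "\<psi> \<in> carrier (hom_group AG D (G\<lparr>carrier := C\<rparr>))" and x: "x \<in> A" "\<psi> x = inv x"
  shows "x = \<one>"
proof -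
  have \<psi>_C: "\<psi> a \<in> C" if "a \<in> A" for a
    using \<psi> that by (simp add: carrier_hom_group_iff)
  then have "\<psi> \<in> hom AG AG"
    using \<psi> C_subset by (auto simp: carrier_hom_group_iff hom_def)
  then interpret \<psi>: group_hom AG AG \<psi>
    by unfold_locales
  have \<psi>_pow: "\<psi> (a [^] k) = \<psi> a [^] k" if "a \<in> A" for a and k :: nat
    using \<psi>.hom_nat_pow[of a k] that by (simp add: AG_pow)
  have x_eq: "x = inv (\<psi> x)"
    using x by simp
  \<comment> \<open>Each application of \<open>x = inv (\<psi> x)\<close> turns a
    \<open>p ^ k\<close>-th power of a norm into a \<open>p ^ Suc k\<close>-th power of another one.
    At \<open>k = n\<close> such a power is trivial.\<close>
  have "\<exists>u\<in>A. x = norm u [^] (p ^ k)" for k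
  proof (induction k)
    case 0
    have "x \<in> C"
      using x_eq \<psi>_C[OF x(1)] by (metis C.m_inv_closed)
    then show ?case by (auto simp: C_def)
  next
    case (Suc k)
    then obtain u where u: "u \<in> A" "x = norm u [^] (p ^ k)" by blast
    obtain d where d: "d \<in> D" "norm u = u [^] p \<otimes> d"
      using norm_mod_D[OF u(1)] by blast
    have "\<psi> (norm u) = \<psi> (u [^] p) \<otimes> \<psi> d"
      using \<psi>.hom_mult[of "u [^] p" d] u d D_subset by auto
    also have "\<dots> = \<psi> u [^] p"
      using \<psi> d u \<psi>_C C_subset by (auto simp: carrier_hom_group_iff \<psi>_pow)
    finally have \<psi>_norm: "\<psi> (norm u) = \<psi> u [^] p" .
    obtain v where v: "v \<in> A" "\<psi> u = norm v"
      using \<psi>_C[OF u(1)] by (auto simp: C_def)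
    have "x = inv (norm v [^] (p ^ Suc k))"
      using x_eq u v \<psi>_norm by (simp add: \<psi>_pow nat_pow_pow)
    also have "\<dots> = norm (inv v) [^] (p ^ Suc k)"
      using norm.hom_inv[of v] v by (simp add: nat_pow_inv m_inv_consistent[OF A_subgroup])
    finally show ?case
      using v by blast
  qed
  then obtain u where "u \<in> A" "x = norm u [^] (p ^ n)" by blast
  then show ?thesis
    using pow_order_eq_1[of "norm u"] order_eq by simp
qed

lemma twisted_homs_D_C: "twisted_homs G A g p n D C"
proof unfold_locales
  show "conj 1 c = c" if "c \<in> C" for c
    using that conj_norm by (auto simp: C_def)
  show "\<psi> (g [^] p) \<in> C" if "\<psi> \<in> carrier (hom_group AG D (G\<lparr>carrier := C\<rparr>))" for \<psi>
    using that g_pow_p by (simp add: carrier_hom_group_iff)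
qed (use D_subset C_subset hom_nilpotent in auto)

lemma order_dvd_of_not_D_subset_C:
  assumes "\<not> D \<subseteq> C"
  shows "order G dvd order (AutoGroup G)"
  using twisted_homs.order_dvd_of_not_subset[OF twisted_homs_D_C assms]
    card_dvd_hom(1)[OF C_subgroup C_subset D_subgroup D_subset] pow_C_trivial by blast

text \<open>Here \<open>A\<close> is central of exponent \<open>p\<close>. The maps
  \<open>x \<mapsto> x \<psi>(x)\<close> with \<open>\<psi>\<close> from \<open>A/K\<close> to
  \<open>K\<close> are the transvections along the cyclic subgroup \<open>K\<close>; they are
  injective since \<open>\<psi>\<close> vanishes on its own values.\<close>

lemma order_dvd_of_elementary:
  assumes noncyc: "\<And>x. x \<in> A \<Longrightarrow> A \<noteq> {x [^] (i::int) \<otimes> k | i k. k \<in> D}"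
    and D: "D = {\<one>}" and C: "C = {\<one>}"
  shows "order G dvd order (AutoGroup G)"
proof -
  have pow_p: "a [^] p = \<one>" if "a \<in> A" for a
  proof -
    have "norm a \<in> C"
      using that by (simp add: C_def)
    then show ?thesis
      using norm_mod_D[OF that] D C that by auto
  qed
  have "A \<noteq> {\<one>}"
  proof
    assume "A = {\<one>}"
    also have "\<dots> = {\<one> [^] (i::int) \<otimes> k | i k. k \<in> D}"
      using D by simp
    finally show False
      using noncyc[OF A.one_closed] by blast
  qed
  then obtain a where a: "a \<in> A" "a \<noteq> \<one>"
    using A.one_closed by blast
  \<comment> \<open>The group generated by \<open>c\<close> has to contain \<open>g [^] p\<close>:
    then every \<open>\<psi>\<close> kills \<open>g [^] p\<close>, as \<open>power_image\<close>
    requires when \<open>C\<close> is trivial.\<close>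
  define c where "c = (if g [^] p = \<one> then a else g [^] p)"
  have c: "c \<in> A" "c \<noteq> \<one>" "g [^] p = \<one> \<or> g [^] p = c"
    using a g_pow_p by (auto simp: c_def)
  define K where "K = range (\<lambda>i::int. c [^] i)"
  have K: "subgroup K G" "K \<subseteq> A"
    using c by (auto simp: K_def intro!: subgroup_of_powers)
  have "c \<in> K"
    using c by (auto simp: K_def intro!: image_eqI[of _ _ 1])
  have z: "g [^] p \<in> K"
    using c(3) \<open>c \<in> K\<close> K(1) by (auto dest: subgroup.one_closed)
  have noncyc_c: "A \<noteq> K"
    using noncyc[OF c(1)] c(1) D by (auto simp: K_def)
  interpret twisted_homs G A g p n K K
  proof unfold_locales
    show "D \<subseteq> K" using D subgroup.one_closed[OF K(1)] by simp
    show "conj 1 x = x" if "x \<in> K" for x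
    proof -
      have x: "x \<in> A" using that K by blast
      then have "conj 1 x \<otimes> inv x = \<one>"
        using D by (auto simp: D_def)
      then show ?thesis
        using x by (metis A.mem_carrier conj_carrier inv_closed inv_equality inv_inv)
    qed
    show "x = \<one>" if "\<psi> \<in> carrier (hom_group AG K (G\<lparr>carrier := K\<rparr>))" "x \<in> A" "\<psi> x = inv x" for \<psi> x
    proof -
      have "inv x \<in> K"
        using that by (metis carrier_hom_group_iff)
      then have "x \<in> K"
        using that(2) K(1) by (metis A.mem_carrier inv_inv subgroup.m_inv_closed)
      then have "\<psi> x = \<one>"
        using that by (simp add: carrier_hom_group_iff)
      then show ?thesis using that by simp
    qed
    show "\<psi> (g [^] p) \<in> C" if "\<psi> \<in> carrier (hom_group AG K (G\<lparr>carrier := K\<rparr>))" for \<psi>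
      using that z C by (simp add: carrier_hom_group_iff)
  qed (use K in \<open>auto simp: subgroup.m_closed subgroup.one_closed subgroup.m_inv_closed\<close>)
  have "card K dvd card H"
  proof (rule card_dvd_hom(1)[OF K K])
    fix e c' assume e: "\<And>y. y \<in> A \<Longrightarrow> y [^] (p ^ e :: nat) \<in> K" and c': "c' \<in> K"
    \<comment> \<open>For \<open>e = 0\<close> the hypothesis would give \<open>A = K\<close>,
      contrary to \<open>A\<close> being noncyclic. For positive \<open>e\<close>, the exponent
      \<open>p\<close> of \<open>A\<close> suffices.\<close>
    have "e \<noteq> 0"
      using e noncyc_c K by (intro notI) auto
    then obtain e' where "e = Suc e'"
      using not0_implies_Suc by blast
    then show "c' [^] (p ^ e) = \<one>"
      using pow_p[of c'] c' K by (auto simp flip: nat_pow_pow)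
  qed
  moreover have "p dvd card K"
  proof -
    obtain m where m: "card K = p ^ m"
      using card_subgroup_prime_power[OF prime_p order_eq K(1)] by blast
    moreover have "card K \<noteq> 1"
      using \<open>c \<in> K\<close> c(2) subgroup.one_closed[OF K(1)] by (auto simp: card_1_singleton_iff)
    ultimately show ?thesis by (cases m) auto
  qed
  ultimately have "p * card C dvd card H"
    using C by auto
  then show ?thesis
    by (rule order_dvd_of_hom)
qed

proposition order_dvd_of_noncyclic:
  assumes "\<And>x. x \<in> A \<Longrightarrow> A \<noteq> {x [^] (i::int) \<otimes> k | i k. k \<in> D}"
  shows "order G dvd order (AutoGroup G)"
proof (cases "D \<subseteq> C")
  case False
  then show ?thesis by (rule order_dvd_of_not_D_subset_C)
next
  case True
  show ?thesis
  proof (cases "C = {\<one>}")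
    case True
    then show ?thesis
      using \<open>D \<subseteq> C\<close> order_dvd_of_elementary[OF assms] D.one_closed by blast
  next
    case False
    then show ?thesis
      using twisted_homs.order_dvd_of_hom[OF twisted_homs_D_C]
        card_dvd_hom(2)[OF C_subgroup C_subset D_subgroup D_subset pow_C_trivial assms] by blast
  qed
qed

end

section \<open>Changing the abelian maximal subgroup\<close>

context cyclic_extension
begin

text \<open>The factor of \<open>y\<close> in the abelian group \<open>A\<close> acts trivially, so
  only the power of \<open>g\<close> counts; thus \<open>D\<close> is in fact
  \<open>[A, G]\<close>.\<close>

lemma commutator_mem_D:
  assumes "a \<in> A" "y \<in> carrier G"
  shows "y \<otimes> a \<otimes> inv y \<otimes> inv a \<in> D"
proof -
  obtain a' and i :: nat where y: "y = a' \<otimes> g [^] i" "a' \<in> A"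
    using generated assms(2) by blast
  have "y \<otimes> a \<otimes> inv y = a' \<otimes> conj i a \<otimes> inv a'"
    using y assms by (simp add: conj_def group_normalize)
  also have "\<dots> = conj i a"
    using y assms A_comm[of a' "conj i a"] by (simp add: m_assoc)
  finally show ?thesis
    using conj_mod_D[OF assms(1)] by simp
qed

lemma A_normal:
  assumes "a \<in> A" "y \<in> carrier G"
  shows "y \<otimes> a \<otimes> inv y \<in> A"
proof -
  have "(y \<otimes> a \<otimes> inv y \<otimes> inv a) \<otimes> a \<in> A"
    using commutator_mem_D[OF assms] D_subset assms by blast
  then show ?thesis
    using assms by (simp add: m_assoc)
qed

lemma coset_pow:
  assumes "a \<in> A" "y \<in> carrier G"
  shows "\<exists>a'\<in>A. (a \<otimes> y) [^] (m::nat) = a' \<otimes> y [^] m"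
proof (induction m)
  case 0
  then show ?case by auto
next
  case (Suc m)
  then obtain a' where a': "a' \<in> A" "(a \<otimes> y) [^] m = a' \<otimes> y [^] m" by blast
  then have "(a \<otimes> y) [^] Suc m = (a' \<otimes> (y [^] m \<otimes> a \<otimes> inv (y [^] m))) \<otimes> y [^] Suc m"
    using assms by (simp add: group_normalize)
  then show ?case
    using a' A_normal[OF assms(1), of "y [^] m"] assms by blast
qed

lemma pow_p_mem:
  assumes "y \<in> carrier G"
  shows "y [^] p \<in> A"
proof -
  obtain a and i :: nat where y: "y = a \<otimes> g [^] i" "a \<in> A"
    using generated assms by blast
  then obtain a' where "a' \<in> A" "y [^] p = a' \<otimes> (g [^] i) [^] p"
    using coset_pow[of a "g [^] i" p] by auto
  then show ?thesis
    using pow_mem_iff[of "i * p"] g_carrier by (simp add: nat_pow_pow)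
qed

text \<open>Any \<open>h\<close> outside \<open>A\<close> generates \<open>G/A\<close>: if
  \<open>h\<close> lies in the coset of \<open>g [^] r\<close>, then \<open>p\<close> does not
  divide \<open>r\<close>, and an inverse \<open>m\<close> of \<open>r\<close> modulo
  \<open>p\<close> brings \<open>h [^] m\<close> into the coset of \<open>g\<close>.\<close>

lemma generated_by_notin:
  assumes "h \<in> carrier G" "h \<notin> A" "x \<in> carrier G"
  shows "\<exists>a\<in>A. \<exists>m::nat. x = a \<otimes> h [^] m"
proof -
  obtain a and r :: nat where h: "h = a \<otimes> g [^] r" "a \<in> A"
    using generated assms(1) by blast
  have "g [^] r \<notin> A"
    using h assms by auto
  then have "\<not> p dvd r"
    using pow_mem_iff[of r] by blast
  then have "r \<noteq> 0"
    by (intro notI) simp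
  have "gcd r p = 1"
    using prime_p \<open>\<not> p dvd r\<close> by (metis coprime_imp_gcd_eq_1 coprime_commute prime_imp_coprime)
  then obtain m q where rm: "r * m = p * q + 1"
    using bezout_nat[OF \<open>r \<noteq> 0\<close>, of p] by auto
  obtain a2 where a2: "a2 \<in> A" "h [^] m = a2 \<otimes> (g [^] r) [^] m"
    using coset_pow[OF h(2), of "g [^] r" m] h by auto
  have "(g [^] r) [^] m = g [^] (p * q) \<otimes> g"
    using rm g_carrier by (simp add: nat_pow_pow)
  then have hm: "h [^] m = (a2 \<otimes> g [^] (p * q)) \<otimes> g"
    using a2 g_carrier by (simp add: m_assoc)
  define a3 where "a3 = a2 \<otimes> g [^] (p * q)"
  have "a3 \<in> A"
    using a2 pow_mem_iff[of "p * q"] by (simp add: a3_def)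
  moreover from this have "g = inv a3 \<otimes> h [^] m"
    unfolding hm a3_def[symmetric] using g_carrier by (simp add: mult_inv_cancel)
  ultimately have a3: "a3 \<in> A" "g = inv a3 \<otimes> h [^] m"
    by blast+
  obtain a4 and i :: nat where x: "x = a4 \<otimes> g [^] i" "a4 \<in> A"
    using generated assms(3) by blast
  obtain a5 where "a5 \<in> A" "g [^] i = a5 \<otimes> (h [^] m) [^] i"
    using coset_pow[of "inv a3" "h [^] m" i] a3 assms(1) by auto
  then have "x = (a4 \<otimes> a5) \<otimes> h [^] (m * i)" "a4 \<otimes> a5 \<in> A"
    using x assms(1) by (auto simp: m_assoc nat_pow_pow)
  then show ?thesis by blast
qed

lemma central_of_commutes_notin:
  assumes "h \<in> carrier G" "h \<notin> A" "c \<in> A" "h \<otimes> c = c \<otimes> h" "x \<in> carrier G"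
  shows "x \<otimes> c = c \<otimes> x"
proof -
  obtain a and m :: nat where x: "x = a \<otimes> h [^] m" "a \<in> A"
    using generated_by_notin assms by blast
  have "h [^] m \<otimes> c = c \<otimes> h [^] m"
    using group_commutes_pow[OF assms(4,1)] assms(3) by simp
  then have "x \<otimes> c = (a \<otimes> c) \<otimes> h [^] m"
    using x assms by (simp add: m_assoc)
  also have "\<dots> = c \<otimes> x"
    using x assms A_comm[of a c] by (simp add: m_assoc)
  finally show ?thesis .
qed

lemma int_pow_eq_nat_pow:
  assumes "x \<in> carrier G"
  shows "\<exists>k::nat. x [^] (i::int) = x [^] k"
proof -
  have N: "0 < p ^ n"
    using prime_gt_0_nat[OF prime_p] by simp
  have "i = int (p ^ n) * (i div int (p ^ n)) + i mod int (p ^ n)"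
    by simp
  then have "x [^] i = (x [^] (p ^ n)) [^] (i div int (p ^ n)) \<otimes> x [^] (i mod int (p ^ n))"
    using assms by (metis int_pow_mult int_pow_nat_pow(2))
  then have "x [^] i = x [^] (i mod int (p ^ n))"
    using pow_order_eq_1[OF assms] order_eq assms by simp
  moreover have "i mod int (p ^ n) = int (nat (i mod int (p ^ n)))"
    using N by simp
  ultimately show ?thesis
    by (metis int_pow_int)
qed

text \<open>The exponent \<open>i\<close> is prime to the group order \<open>p ^ n\<close>, so
  \<open>x\<close> is a power of \<open>x [^] i\<close>.\<close>

lemma mem_of_coprime_pow:
  assumes "subgroup L G" "x \<in> carrier G" "x [^] (i::int) \<in> L" "\<not> int p dvd i"
  shows "x \<in> L"
proof -
  have "x [^] int (p ^ n) \<in> L"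
    using pow_order_eq_1[OF assms(2)] order_eq subgroup.one_closed[OF assms(1)]
    by (simp add: int_pow_int del: of_nat_power)
  then have "x [^] gcd i (int (p ^ n)) \<in> L"
    using int_pow_gcd_mem[OF assms(1-3)] by blast
  moreover have "gcd i (int (p ^ n)) = 1"
  proof -
    have "coprime i (int p)"
      using assms(4) prime_p by (metis coprime_commute prime_imp_coprime prime_nat_int_transfer)
    then show ?thesis
      by (simp add: coprime_imp_gcd_eq_1)
  qed
  ultimately show ?thesis
    using assms(2) by simp
qed

text \<open>The roles of \<open>a\<close> and an outside element \<open>h\<close> are exchanged over
  a central subgroup \<open>Z\<close>. The new subgroup is abelian because \<open>Z\<close> is
  central, and \<open>a\<close> normalizes it because commutators of \<open>a\<close> with powers of
  \<open>h\<close> lie in \<open>D\<close>, hence in \<open>Z\<close>. Together with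
  \<open>a\<close> it gives all of \<open>G\<close>, since \<open>A\<close> is generated by
  \<open>a\<close> and \<open>D\<close>.\<close>

lemma cyclic_extension_switch:
  assumes a: "a \<in> A" "a \<notin> Z" "a [^] p \<in> Z" "A = {a [^] (i::int) \<otimes> d | i d. d \<in> D}"
    and Z: "subgroup Z G" "D \<subseteq> Z" "Z \<subseteq> A" "\<And>x z. \<lbrakk>x \<in> carrier G; z \<in> Z\<rbrakk> \<Longrightarrow> x \<otimes> z = z \<otimes> x"
    and h: "h \<in> carrier G" "h \<notin> A" "h [^] p \<in> Z"
  shows "cyclic_extension G {h [^] (i::int) \<otimes> z | i z. z \<in> Z} a p n"
proof -
  interpret Z: subgroup Z G by (rule Z(1))
  define B where "B = {h [^] (i::int) \<otimes> z | i z. z \<in> Z}"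
  have B_I: "h [^] (i::int) \<otimes> z \<in> B" if "z \<in> Z" for i z
    using that by (auto simp: B_def)
  have B_E: "\<exists>i z. x = h [^] (i::int) \<otimes> z \<and> z \<in> Z" if "x \<in> B" for x
    using that by (auto simp: B_def)
  have prod: "(h [^] i \<otimes> z) \<otimes> (h [^] j \<otimes> w) = h [^] (i + j) \<otimes> (z \<otimes> w)"
    if "z \<in> Z" "w \<in> Z" for i j :: int and z w
  proof -
    have "(h [^] i \<otimes> z) \<otimes> (h [^] j \<otimes> w) = h [^] i \<otimes> (z \<otimes> h [^] j) \<otimes> w"
      using that h by (simp add: m_assoc)
    also have "z \<otimes> h [^] j = h [^] j \<otimes> z"
      using Z(4)[of "h [^] j" z] that h by simp
    finally show ?thesis
      using that h by (simp add: int_pow_mult m_assoc)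
  qed
  have conj_h: "\<exists>d\<in>D. a [^] (k::nat) \<otimes> h [^] i = h [^] i \<otimes> d \<otimes> a [^] k" for i :: int and k
  proof
    let ?d = "inv (h [^] i) \<otimes> a [^] k \<otimes> inv (inv (h [^] i)) \<otimes> inv (a [^] k)"
    show "?d \<in> D"
      using commutator_mem_D[of "a [^] k" "inv (h [^] i)"] a h by simp
    show "a [^] k \<otimes> h [^] i = h [^] i \<otimes> ?d \<otimes> a [^] k"
      using a h by (simp add: m_assoc mult_inv_cancel)
  qed
  have "cyclic_extension G B a p n"
  proof (intro cyclic_extension.intro cyclic_extension_axioms.intro)
    show "group G" by (rule is_group)
    show "Factorial_Ring.prime p" "finite (carrier G)" "order G = p ^ n" "a \<in> carrier G"
      using prime_p finite_carrier order_eq a by auto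
    show "subgroup B G"
    proof (rule finite_mult_closed_subgroup[OF finite_carrier])
      show "B \<subseteq> carrier G" using h by (auto simp: B_def)
      show "B \<noteq> {}" using B_I[OF Z.one_closed] by blast
      show "x \<otimes> y \<in> B" if x: "x \<in> B" and y: "y \<in> B" for x y
      proof -
        obtain i z j w where "x = h [^] (i::int) \<otimes> z" "z \<in> Z" "y = h [^] (j::int) \<otimes> w" "w \<in> Z"
          using B_E[OF x] B_E[OF y] by blast
        then show ?thesis
          using B_I[of "z \<otimes> w"] by (simp add: prod)
      qed
    qed
    show "x \<otimes> y = y \<otimes> x" if x: "x \<in> B" and y: "y \<in> B" for x y
    proof -
      obtain i z j w where xy: "x = h [^] (i::int) \<otimes> z" "z \<in> Z" "y = h [^] (j::int) \<otimes> w" "w \<in> Z"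
        using B_E[OF x] B_E[OF y] by blast
      then show ?thesis
        using Z(4)[of z w] by (simp add: prod add.commute)
    qed
    show "a \<notin> B"
    \<comment> \<open>If \<open>a = h [^] i \<otimes> z\<close>, then \<open>h [^] i\<close> lies in
      \<open>A\<close>, so \<open>p\<close> divides \<open>i\<close> and \<open>h [^] i\<close> lies
      in \<open>Z\<close>; this would put \<open>a\<close> into \<open>Z\<close>.\<close>
    proof
      assume "a \<in> B"
      then obtain i z where iz: "a = h [^] (i::int) \<otimes> z" "z \<in> Z"
        using B_E by blast
      have hi: "h [^] i = a \<otimes> inv z"
        using iz h by (simp add: inv_solve_right)
      have "a \<otimes> inv z \<in> A"
        using a(1) iz(2) Z(3) by auto
      then have "h [^] i \<in> A"
        by (simp only: hi)
      then have "int p dvd i"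
        using prime_dvd_of_int_pow_mem[OF prime_p A_subgroup h(1,2)] h(3) Z(3) by blast
      then obtain m where "i = int p * m" by blast
      then have "h [^] i = (h [^] p) [^] m"
        using h by (simp add: int_pow_nat_pow)
      then have "h [^] i \<in> Z"
        using subgroup_int_pow_closed[OF Z(1) h(3)] by simp
      then have "h [^] i \<otimes> z \<in> Z"
        using iz by blast
      then show False
        using iz a(2) by simp
    qed
    show "a [^] p \<in> B"
      using B_I[OF a(3), of 0] a by simp
    show "a \<otimes> x \<otimes> inv a \<in> B" if x: "x \<in> B" for x
    proof -
      obtain i z where iz: "x = h [^] (i::int) \<otimes> z" "z \<in> Z"
        using B_E[OF x] by blast
      obtain d where d: "d \<in> D" "a \<otimes> h [^] i = h [^] i \<otimes> d \<otimes> a"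
        using conj_h[of 1 i] a by auto
      have "a \<otimes> x \<otimes> inv a = (a \<otimes> h [^] i) \<otimes> z \<otimes> inv a"
        using iz a h by (simp add: m_assoc)
      also have "\<dots> = h [^] i \<otimes> d \<otimes> (a \<otimes> z) \<otimes> inv a"
        using iz d a h by (simp add: m_assoc)
      also have "\<dots> = h [^] i \<otimes> (d \<otimes> z)"
        using Z(4)[of a z] iz d a h by (simp add: m_assoc)
      finally show ?thesis
        using B_I[of "d \<otimes> z" i] d iz Z(2) by auto
    qed
    show "\<exists>b\<in>B. \<exists>i::nat. x = b \<otimes> a [^] i" if x: "x \<in> carrier G" for x
    proof -
      obtain a' and m :: nat where x: "x = a' \<otimes> h [^] m" "a' \<in> A"
        using generated_by_notin[OF h(1,2) x] by blast
      then obtain j e where e: "a' = a [^] (j::int) \<otimes> e" "e \<in> D"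
        using a(4) by blast
      obtain k :: nat where k: "a [^] j = a [^] k"
        using int_pow_eq_nat_pow[of a j] a by auto
      obtain d where d: "d \<in> D" "a [^] k \<otimes> h [^] int m = h [^] int m \<otimes> d \<otimes> a [^] k"
        using conj_h[of k "int m"] by blast
      have "x = (a [^] k \<otimes> e) \<otimes> h [^] int m"
        using x(1) e(1) k by (simp add: int_pow_int)
      also have "a [^] k \<otimes> e = e \<otimes> a [^] k"
        using A_comm[of "a [^] k" e] e(2) a(1) D_subset by auto
      also have "e \<otimes> a [^] k \<otimes> h [^] int m = e \<otimes> (a [^] k \<otimes> h [^] int m)"
        using e(2) a(1) h(1) by (simp add: m_assoc)
      also have "\<dots> = e \<otimes> (h [^] int m \<otimes> d) \<otimes> a [^] k"
        using d e a h by (simp add: m_assoc)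
      also have "e \<otimes> (h [^] int m \<otimes> d) = h [^] int m \<otimes> (d \<otimes> e)"
      proof -
        have hd: "h [^] int m \<otimes> d \<in> carrier G" and eZ: "e \<in> Z"
          using d(1) e(2) h(1) Z(2) by auto
        show ?thesis
          unfolding Z(4)[OF hd eZ, symmetric] using d(1) e(2) h(1) by (simp add: m_assoc)
      qed
      finally show ?thesis
        using B_I[of "d \<otimes> e" "int m"] d e Z(2) by blast
    qed
  qed
  then show ?thesis
    by (simp add: B_def)
qed

end

section \<open>The remaining case: \<open>A/D\<close> cyclic and \<open>D\<close> contained in
  \<open>C\<close>\<close>

locale cyclic_quotient = cyclic_extension +
  fixes a :: 'a
  assumes a: "a \<in> A"
    and A_eq: "A = {a [^] (i::int) \<otimes> d | i d. d \<in> D}"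
    and D_C: "D \<subseteq> C"
    and not_cyclic: "\<not> cyclic_group G"
begin

definition b :: 'a
  where "b = conj 1 a \<otimes> inv a"

lemma D_central: "d \<in> D \<Longrightarrow> x \<in> carrier G \<Longrightarrow> x \<otimes> d = d \<otimes> x"
  using D_C norm_central by (auto simp: C_def)

lemma b_D: "b \<in> D"
  using a by (auto simp: b_def D_def)

lemma b_A: "b \<in> A"
  using b_D D_subset by blast

lemma conj_a: "conj 1 a = b \<otimes> a"
  using a by (simp add: b_def m_assoc)

lemma conj_pow_a: "conj 1 (a [^] (i::int)) = b [^] i \<otimes> a [^] i"
proof -
  interpret c: group_hom AG AG "conj 1"
    by unfold_locales (rule conj_hom)
  have "conj 1 (a [^] i) = (b \<otimes> a) [^] i"
    using c.hom_int_pow[of a i] a b_A by (simp only: AG_int_pow conj_a) (simp add: AG_int_pow conj_a)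
  also have "\<dots> = b [^] i \<otimes> a [^] i"
    using AG.int_pow_distrib[of b a i] a b_A by (simp add: AG_int_pow)
  finally show ?thesis .
qed

lemma conj_d: "d \<in> D \<Longrightarrow> conj i d = d"
  using D_central[of d "g [^] i"] by (simp add: conj_def m_assoc)

text \<open>Since \<open>D\<close> is central, the commutator of \<open>g\<close> with
  \<open>a [^] i \<otimes> d\<close> is just \<open>b [^] i\<close>.\<close>

lemma D_eq: "D = range (\<lambda>i::int. b [^] i)"
proof
  show "D \<subseteq> range (\<lambda>i::int. b [^] i)"
  proof
    fix x assume "x \<in> D"
    then obtain y where y: "y \<in> A" "x = conj 1 y \<otimes> inv y"
      by (auto simp: D_def)
    then obtain i d where "y = a [^] (i::int) \<otimes> d" "d \<in> D"
      using A_eq by blast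
    then have "x = b [^] i"
      using y a b_A by (simp add: conj_mult conj_pow_a conj_d group_normalize del: One_nat_def)
    then show "x \<in> range (\<lambda>i::int. b [^] i)" by blast
  qed
  show "range (\<lambda>i::int. b [^] i) \<subseteq> D"
    using subgroup_int_pow_closed[OF D_subgroup b_D] by blast
qed

text \<open>As \<open>b\<close> is central, \<open>conj k\<close> multiplies \<open>a\<close> by
  \<open>b [^] k\<close>, and \<open>conj p\<close> is trivial on \<open>A\<close>.\<close>

lemma b_pow_p: "b [^] p = \<one>"
proof -
  have "conj k a = b [^] k \<otimes> a" for k
  proof (induction k)
    case (Suc k)
    have "conj (Suc k) a = conj 1 (conj k a)"
      using a by (simp add: conj_conj)
    also have "\<dots> = b [^] k \<otimes> (b \<otimes> a)"
      using Suc conj_a conj_d[of "b [^] k" 1] subgroup_int_pow_closed[OF D_subgroup b_D, of "int k"] a b_A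
      by (simp add: conj_mult int_pow_int)
    finally show ?case
      using a b_A by (simp add: m_assoc)
  qed (use a in simp)
  then have "b [^] p \<otimes> a = a"
    using conj_of_pow[OF a] by simp
  then show ?thesis
    using a b_A by simp
qed

lemma D_pow_p:
  assumes "d \<in> D"
  shows "d [^] p = \<one>"
proof -
  obtain i where "d = b [^] (i::int)"
    using assms D_eq by blast
  then have "d [^] p = (b [^] p) [^] i"
    using b_A by (simp add: int_pow_nat_pow mult.commute)
  then show ?thesis
    by (simp add: b_pow_p)
qed

lemma a_pow_p_central:
  assumes "x \<in> carrier G"
  shows "x \<otimes> a [^] p = a [^] p \<otimes> x"
proof -
  have "conj 1 (a [^] p) = a [^] p"
    using conj_pow_a[of "int p"] b_pow_p a by (simp add: int_pow_int)
  then have "g \<otimes> a [^] p = a [^] p \<otimes> g"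
    using pow_mult_eq[of "a [^] p" 1] a g_carrier by simp
  then show ?thesis
    using central_iff[of "a [^] p"] a assms by simp
qed

text \<open>If \<open>p\<close> did not divide the exponent \<open>k\<close>, then
  \<open>b [^] k = \<one>\<close>, because \<open>g\<close> fixes \<open>g [^] p\<close>. So
  \<open>b\<close> and \<open>D\<close> would be trivial, and \<open>a\<close> would be a power of
  \<open>g\<close> since \<open>a [^] k = g [^] p\<close>. Then \<open>G\<close> would be
  cyclic.\<close>

lemma g_pow_eq: "\<exists>k d. g [^] p = a [^] (int p * k) \<otimes> d \<and> d \<in> D"
proof -
  obtain k d where kd: "g [^] p = a [^] (k::int) \<otimes> d" "d \<in> D"
    using g_pow_p A_eq by blast
  have "int p dvd k"
  proof (rule ccontr)
    assume k: "\<not> int p dvd k"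
    have "conj 1 (g [^] p) = g [^] p"
      using norm_conj g_carrier by (simp add: conj_def nat_pow_mult m_assoc flip: nat_pow_Suc2)
    then have "b [^] k \<otimes> a [^] k \<otimes> d = a [^] k \<otimes> d"
      using kd a b_A by (simp add: conj_mult conj_pow_a conj_d del: One_nat_def)
    then have "b [^] k = \<one>"
      using kd a b_A by (simp add: m_assoc)
    then have "b = \<one>"
      using mem_of_coprime_pow[OF triv_subgroup, of b k] k b_A by simp
    then have D1: "D = {\<one>}"
      by (auto simp: D_eq)
    let ?L = "range (\<lambda>i::int. g [^] i)"
    have L: "subgroup ?L G"
      by (rule subgroup_of_powers[OF g_carrier])
    have g_L: "g [^] (i::nat) \<in> ?L" for i
      by (rule image_eqI[of _ _ "int i"]) (simp_all add: int_pow_int)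
    have "a [^] k \<in> ?L"
      using g_L[of p] kd D1 a by simp
    then have "a \<in> ?L"
      by (rule mem_of_coprime_pow[OF L A.mem_carrier[OF a] _ k])
    then have a_L: "a [^] (i::int) \<in> ?L" for i
      by (rule subgroup_int_pow_closed[OF L])
    have "A \<subseteq> ?L"
    proof
      fix x assume "x \<in> A"
      then obtain i e where "x = a [^] (i::int) \<otimes> e" "e \<in> D"
        using A_eq by blast
      then have "x = a [^] i"
        using D1 a by simp
      then show "x \<in> ?L"
        using a_L by simp
    qed
    then have "carrier G \<subseteq> ?L"
      using generated g_L subgroup.m_closed[OF L] by (metis subsetD subsetI)
    then have "carrier G = ?L"
      using g_carrier by blast
    then show False
      using not_cyclic cyclic_group g_carrier by blast
  qed
  then show ?thesis using kd by blast
qed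

text \<open>The new subgroup \<open>B\<close> is generated by an outside element \<open>h\<close>
  with \<open>h [^] p\<close> in \<open>D\<close> together with the central group \<open>Z\<close>
  generated by \<open>a [^] p\<close> and \<open>D\<close>. Modulo \<open>D\<close> it needs both
  \<open>h\<close> and \<open>a [^] p\<close>, so its quotient by the smaller \<open>N.D\<close> is
  not cyclic and the noncyclic case applies to it.\<close>

lemma order_dvd_of_pow_notin_D:
  assumes ap: "a [^] p \<notin> D"
  shows "order G dvd order (AutoGroup G)"
proof -
  obtain k d where kd: "g [^] p = a [^] (int p * k) \<otimes> d" "d \<in> D"
    using g_pow_eq by blast
  \<comment> \<open>Modulo \<open>D\<close>, the norm of \<open>a [^] (- k)\<close> is
    \<open>a [^] (- (int p * k))\<close>, which cancels the power of \<open>a\<close> in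
    \<open>g [^] p\<close>.\<close>
  define h where "h = a [^] (- k) \<otimes> g"
  have h: "h \<in> carrier G" "h \<notin> A"
  proof -
    show "h \<in> carrier G" using a g_carrier by (simp add: h_def)
    show "h \<notin> A"
    proof
      assume "h \<in> A"
      then have "inv (a [^] (- k)) \<otimes> h \<in> A"
        using a by simp
      then show False
        using a g_carrier g_notin by (simp add: h_def mult_inv_cancel)
    qed
  qed
  have hp: "h [^] p \<in> D"
  proof -
    obtain d' where d': "d' \<in> D" "norm (a [^] (- k)) = (a [^] (- k)) [^] p \<otimes> d'"
      using norm_mod_D[of "a [^] (- k)"] a by auto
    have "h [^] p = norm (a [^] (- k)) \<otimes> g [^] p"
      using norm_eq[of "a [^] (- k)"] a by (simp add: h_def)
    also have "\<dots> = a [^] (- (int p * k)) \<otimes> d' \<otimes> (a [^] (int p * k) \<otimes> d)"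
      using d' kd a by (simp add: int_pow_nat_pow mult.commute)
    also have "\<dots> = (a [^] (- (int p * k)) \<otimes> a [^] (int p * k)) \<otimes> (d' \<otimes> d)"
      using d' kd a D_subset by (simp add: A_ac subset_iff)
    also have "\<dots> = d' \<otimes> d"
      using d' kd a by (simp add: int_pow_neg)
    finally show ?thesis
      using d' kd by simp
  qed
  define Z where "Z = {(a [^] p) [^] (i::int) \<otimes> d | i d. d \<in> D}"
  have Z: "subgroup Z G" "D \<subseteq> Z" "a [^] p \<in> Z" "Z \<subseteq> A"
  proof -
    have Z_eq: "Z = {(a [^] p) [^]\<^bsub>AG\<^esub> (i::int) \<otimes>\<^bsub>AG\<^esub> d | i d. d \<in> D}"
      using a by (simp add: Z_def AG_int_pow)
    have "subgroup Z AG"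
      using AG.subgroup_adjoin[OF subgroup_AG[OF D_subgroup D_subset], of "a [^] p"] a Z_eq by simp
    then show "subgroup Z G" "Z \<subseteq> A"
      using incl_subgroup[OF A_subgroup] subgroup.subset[of Z AG] by auto
    show "D \<subseteq> Z" "a [^] p \<in> Z"
      using AG.adjoin_incl[OF subgroup_AG[OF D_subgroup D_subset], of "a [^] p"] a Z_eq by auto
  qed
  have Z_central: "x \<otimes> z = z \<otimes> x" if x: "x \<in> carrier G" and z: "z \<in> Z" for x z
  proof -
    obtain i d where z: "z = (a [^] p) [^] (i::int) \<otimes> d" "d \<in> D"
      using z by (auto simp: Z_def)
    obtain m :: nat where m: "(a [^] p) [^] i = (a [^] p) [^] m"
      using int_pow_eq_nat_pow[of "a [^] p" i] a by auto
    have "(a [^] p) [^] m \<otimes> x = x \<otimes> (a [^] p) [^] m"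
      using group_commutes_pow[OF a_pow_p_central[OF x, symmetric]] a x by simp
    then have "x \<otimes> z = (a [^] p) [^] m \<otimes> (x \<otimes> d)"
      using z m a x by (simp flip: m_assoc)
    then show ?thesis
      using z m a x D_central[of d x] by (simp add: m_assoc)
  qed
  \<comment> \<open>Otherwise \<open>a [^] (1 - int p * i)\<close> lies in \<open>D\<close> for some
    \<open>i\<close>. This exponent is prime to \<open>p\<close>, so \<open>a\<close> and then
    \<open>a [^] p\<close> would lie in \<open>D\<close>.\<close>
  have "a \<notin> Z"
  proof
    assume "a \<in> Z"
    then obtain i d where id: "a = (a [^] p) [^] (i::int) \<otimes> d" "d \<in> D"
      by (auto simp: Z_def)
    define c where "c = a [^] (int p * i)"
    have c: "c \<in> carrier G"
      using a by (simp add: c_def)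
    have "a = c \<otimes> d"
      using id a by (simp add: c_def int_pow_nat_pow)
    then have "inv c \<otimes> a = d"
      using c id(2) by (simp add: mult_inv_cancel)
    then have "inv (a [^] (int p * i)) \<otimes> a [^] (1::int) = d"
      using a by (simp add: c_def)
    then have "a [^] (- (int p * i) + 1) = d"
      using a by (simp only: int_pow_mult A.mem_carrier int_pow_neg)
    moreover have "\<not> int p dvd - (int p * i) + 1"
    proof
      assume "int p dvd - (int p * i) + 1"
      then have "int p dvd (- (int p * i) + 1) + int p * i"
        by (rule dvd_add) simp
      then show False
        using prime_gt_1_nat[OF prime_p] by simp
    qed
    ultimately have "a \<in> D"
      using mem_of_coprime_pow[OF D_subgroup _ _] a id(2) by (metis A.mem_carrier)
    then have "a [^] p \<in> D"
      using subgroup_int_pow_closed[OF D_subgroup, of a "int p"] by (simp add: int_pow_int)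
    then show False using ap by simp
  qed
  define B where "B = {h [^] (i::int) \<otimes> z | i z. z \<in> Z}"
  interpret N: cyclic_extension G B a p n
    unfolding B_def
    using cyclic_extension_switch[OF a \<open>a \<notin> Z\<close> Z(3) A_eq Z(1,2,4) Z_central h] hp Z(2) by blast
  have N_D: "N.D \<subseteq> D"
  proof
    fix x assume "x \<in> N.D"
    then obtain y where y: "y \<in> B" "x = a \<otimes> y \<otimes> inv a \<otimes> inv y"
      using a by (auto simp: N.D_def N.conj_def)
    have "x = inv (y \<otimes> a \<otimes> inv y \<otimes> inv a)"
      using y a by (simp add: group_normalize)
    then show "x \<in> D"
      using commutator_mem_D[OF a, of y] y by auto
  qed
  have h_B: "h \<in> B" "a [^] p \<in> B"
  proof -
    have "h [^] (1::int) \<otimes> \<one> \<in> B" "h [^] (0::int) \<otimes> a [^] p \<in> B"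
      using Z(3) subgroup.one_closed[OF Z(1)] unfolding B_def by blast+
    then show "h \<in> B" "a [^] p \<in> B"
      using h a by auto
  qed
  \<comment> \<open>Suppose \<open>y\<close> generates \<open>B\<close> modulo \<open>N.D\<close>,
    and \<open>h\<close> is \<open>y [^] u\<close> modulo \<open>D\<close>. If \<open>p\<close>
    divides \<open>u\<close>, then \<open>h\<close> falls into \<open>A\<close>. Otherwise
    \<open>y\<close> lies in the group \<open>L\<close> generated by \<open>h\<close> and
    \<open>D\<close>, hence so does \<open>a [^] p\<close>; but \<open>L\<close> meets
    \<open>A\<close> only in \<open>D\<close>.\<close>
  have "B \<noteq> {y [^] (i::int) \<otimes> k | i k. k \<in> N.D}" if y: "y \<in> B" for y
  proof
    assume B_eq: "B = {y [^] (i::int) \<otimes> k | i k. k \<in> N.D}"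
    obtain u d1 where u: "h = y [^] (u::int) \<otimes> d1" "d1 \<in> D"
      using h_B(1) B_eq N_D by blast
    obtain v d2 where v: "a [^] p = y [^] (v::int) \<otimes> d2" "d2 \<in> D"
      using h_B(2) B_eq N_D by blast
    have yG: "y \<in> carrier G"
      using y by simp
    show False
    proof (cases "int p dvd u")
      case True
      then obtain u' where "u = int p * u'" by blast
      then have "y [^] u \<in> A"
        using int_pow_mem[OF pow_p_mem[OF yG], of u'] yG by (simp add: int_pow_nat_pow)
      then show False
        using u h(2) D_subset by auto
    next
      case False
      define L where "L = {h [^] (i::int) \<otimes> d | i d. d \<in> D}"
      have L: "subgroup L G"
      proof (rule finite_mult_closed_subgroup[OF finite_carrier])
        show "L \<subseteq> carrier G" using h by (auto simp: L_def)
        show "L \<noteq> {}" using D.one_closed unfolding L_def by blast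
        show "r \<otimes> s \<in> L" if "r \<in> L" "s \<in> L" for r s
        proof -
          obtain i d j e where rs: "r = h [^] (i::int) \<otimes> d" "d \<in> D" "s = h [^] (j::int) \<otimes> e" "e \<in> D"
            using \<open>r \<in> L\<close> \<open>s \<in> L\<close> by (auto simp: L_def)
          have "r \<otimes> s = h [^] i \<otimes> (d \<otimes> h [^] j) \<otimes> e"
            using rs h by (simp add: m_assoc)
          also have "d \<otimes> h [^] j = h [^] j \<otimes> d"
            using D_central[of d "h [^] j"] rs h by simp
          finally have "r \<otimes> s = h [^] (i + j) \<otimes> (d \<otimes> e)"
            using rs h by (simp add: m_assoc int_pow_mult)
          then show ?thesis
            using rs by (auto simp: L_def)
        qed
      qed
      interpret L: subgroup L G by (rule L)
      have D_L: "D \<subseteq> L" and h_L: "h \<in> L"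
      proof -
        have "h [^] (0::int) \<otimes> d \<in> L" if "d \<in> D" for d
          using that unfolding L_def by blast
        then show "D \<subseteq> L" by auto
        have "h [^] (1::int) \<otimes> \<one> \<in> L"
          using D.one_closed unfolding L_def by blast
        then show "h \<in> L" using h by simp
      qed
      have yu: "y [^] u = h \<otimes> inv d1"
        using u yG by (simp add: inv_solve_right)
      have "h \<otimes> inv d1 \<in> L"
        using u(2) h_L D_L by auto
      then have "y [^] u \<in> L"
        by (simp only: yu)
      then have "y \<in> L"
        using mem_of_coprime_pow[OF L yG _ False] by blast
      then have "a [^] p \<in> L"
        using v D_L subgroup_int_pow_closed[OF L, of y v] by auto
      then obtain i d where id: "a [^] p = h [^] (i::int) \<otimes> d" "d \<in> D"
        by (auto simp: L_def)
      have hi: "h [^] i = a [^] p \<otimes> inv d"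
        using id h a by (simp add: inv_solve_right)
      have "a [^] p \<otimes> inv d \<in> A"
        using id(2) a D_subset by auto
      then have "h [^] i \<in> A"
        by (simp only: hi)
      then have "int p dvd i"
        using prime_dvd_of_int_pow_mem[OF prime_p A_subgroup h] hp D_subset by blast
      then obtain m where "i = int p * m" by blast
      then have "h [^] i = (h [^] p) [^] m"
        using h by (simp add: int_pow_nat_pow)
      then have "h [^] i \<in> D"
        using subgroup_int_pow_closed[OF D_subgroup hp] by simp
      then show False
        using ap id by auto
    qed
  qed
  then show ?thesis
    by (rule N.order_dvd_of_noncyclic)
qed

text \<open>The second abelian subgroup \<open>B\<close> is generated by \<open>D\<close> and an
  outside element \<open>c\<close> chosen so that the norm map for \<open>a\<close> is trivial on
  \<open>B\<close>. Since \<open>a\<close> is not central, \<open>N.D\<close> is nontrivial and so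
  not contained in \<open>N.C\<close>. The order bound serves to exclude \<open>b = \<one>\<close>,
  where \<open>A\<close> would have at most \<open>p\<close> elements.\<close>

lemma order_dvd_of_pow_in_D:
  assumes ap: "a [^] p \<in> D" and order: "order G \<ge> p ^ 3"
  shows "order G dvd order (AutoGroup G)"
proof -
  have "b \<noteq> \<one>"
  proof
    assume "b = \<one>"
    then have D1: "D = {\<one>}"
      by (auto simp: D_eq)
    have "A \<subseteq> (\<lambda>i. a [^] i) ` {..<p}"
    proof
      fix x assume "x \<in> A"
      then obtain i where "x = a [^] (i::int)"
        using A_eq D1 a by auto
      then obtain m :: nat where "x = a [^] m"
        using int_pow_eq_nat_pow[of a i] a by auto
      also have "\<dots> = a [^] (p * (m div p)) \<otimes> a [^] (m mod p)"
        using a by (simp add: nat_pow_mult)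
      also have "a [^] (p * (m div p)) = (a [^] p) [^] (m div p)"
        using a by (simp add: nat_pow_pow)
      finally have "x = a [^] (m mod p)"
        using ap D1 a by simp
      then show "x \<in> (\<lambda>i. a [^] i) ` {..<p}"
        using prime_gt_0_nat[OF prime_p] by simp
    qed
    then have "card A \<le> p"
      by (metis card_image_le card_lessThan card_mono finite_imageI finite_lessThan le_trans)
    then have "order G \<le> p * p"
      by (simp add: card_A)
    moreover have "p * p < p ^ 3"
      using prime_gt_1_nat[OF prime_p] by (simp add: power3_eq_cube)
    ultimately show False
      using order by simp
  qed
  obtain k d where kd: "g [^] p = a [^] (int p * k) \<otimes> d" "d \<in> D"
    using g_pow_eq by blast
  then have gp: "g [^] p \<in> D"
    using subgroup_int_pow_closed[OF D_subgroup ap, of k] a by (simp add: int_pow_nat_pow)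
  \<comment> \<open>Being a norm, this quotient allows \<open>g\<close> to be changed within its
    coset to an element with the same \<open>p\<close>-th power as \<open>a\<close>.\<close>
  have "a [^] p \<otimes> inv (g [^] p) \<in> C"
    using ap gp D_C by auto
  then obtain y0 where y0: "y0 \<in> A" "norm y0 = a [^] p \<otimes> inv (g [^] p)"
    by (auto simp: C_def)
  define y where "y = y0 \<otimes> g"
  have y: "y \<in> carrier G" "y \<notin> A" "y [^] p = a [^] p"
  proof -
    show "y \<in> carrier G" using y0 g_carrier by (simp add: y_def)
    show "y \<notin> A"
    proof
      assume "y \<in> A"
      then have "inv y0 \<otimes> y \<in> A"
        using y0 by simp
      then show False
        using y0 g_carrier g_notin by (simp add: y_def mult_inv_cancel)
    qed
    show "y [^] p = a [^] p"
      using norm_eq[OF y0(1)] y0 a by (simp add: y_def m_assoc)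
  qed
  define c where "c = y \<otimes> inv a"
  have c: "c \<in> carrier G" "c \<notin> A" "c \<otimes> a = y"
  proof -
    show "c \<in> carrier G" using y a by (simp add: c_def)
    show ca: "c \<otimes> a = y" using y a by (simp add: c_def m_assoc)
    then show "c \<notin> A" using y(2) a by auto
  qed
  \<comment> \<open>Centrality of \<open>a [^] i \<otimes> d\<close> forces
    \<open>b [^] i = \<one>\<close>, so \<open>p\<close> divides \<open>i\<close>, and
    \<open>a [^] i\<close> is a power of \<open>a [^] p\<close>, which lies in
    \<open>D\<close>.\<close>
  have central_D: "x \<in> D" if x: "x \<in> A" "\<And>z. z \<in> carrier G \<Longrightarrow> z \<otimes> x = x \<otimes> z" for x
  proof -
    obtain i d where id: "x = a [^] (i::int) \<otimes> d" "d \<in> D"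
      using x(1) A_eq by blast
    have "conj 1 x = x"
      using x(2)[of g] x(1) g_carrier by (simp add: conj_def m_assoc)
    then have "b [^] i \<otimes> a [^] i \<otimes> d = a [^] i \<otimes> d"
      using id a b_A by (simp add: conj_mult conj_pow_a conj_d del: One_nat_def)
    then have "b [^] i \<in> {\<one>}"
      using id a b_A by (simp add: m_assoc)
    then have "int p dvd i"
      using prime_dvd_of_int_pow_mem[OF prime_p triv_subgroup, of b i] b_A b_pow_p \<open>b \<noteq> \<one>\<close> by simp
    then obtain m where "i = int p * m" by blast
    then have "a [^] i \<in> D"
      using subgroup_int_pow_closed[OF D_subgroup ap, of m] a by (simp add: int_pow_nat_pow)
    then show ?thesis
      using id by simp
  qed
  have a_noncentral: "\<not> (\<forall>z\<in>carrier G. z \<otimes> a = a \<otimes> z)"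
  proof
    assume "\<forall>z\<in>carrier G. z \<otimes> a = a \<otimes> z"
    then have "conj 1 a = a"
      using a g_carrier by (simp add: conj_def m_assoc)
    then show False
      using \<open>b \<noteq> \<one>\<close> a by (simp add: b_def)
  qed
  then have aD: "a \<notin> D"
    using D_central by blast
  have cp: "c [^] p \<in> D"
  proof (rule central_D)
    show cpA: "c [^] p \<in> A" by (rule pow_p_mem[OF c(1)])
    show "z \<otimes> c [^] p = c [^] p \<otimes> z" if "z \<in> carrier G" for z
      using central_of_commutes_notin[OF c(1,2) cpA _ that] by (metis c(1) nat_pow_Suc nat_pow_Suc2)
  qed
  define B where "B = {c [^] (i::int) \<otimes> z | i z. z \<in> D}"
  interpret N: cyclic_extension G B a p n
    unfolding B_def
    using cyclic_extension_switch[OF a aD ap A_eq D_subgroup order.refl D_subset _ c(1,2) cp] D_central by blast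
  have B_I: "c [^] (i::int) \<otimes> z \<in> B" if "z \<in> D" for i z
    using that by (auto simp: B_def)
  have c_B: "c \<in> B"
    using B_I[OF D.one_closed, of 1] c(1) by simp
  have D_B: "z \<in> B" if "z \<in> D" for z
    using B_I[OF that, of 0] that by simp
  \<comment> \<open>The new norm of \<open>c\<close> is \<open>(c \<otimes> a) [^] p\<close> divided
    by \<open>a [^] p\<close>, and \<open>c \<otimes> a = y\<close> was built to have that
    \<open>p\<close>-th power.\<close>
  have norm_c: "N.norm c = \<one>"
    using c y a by (simp add: N.norm_def N.partial_norm_def)
  have norm_D: "N.norm z = \<one>" if "z \<in> D" for z
  proof -
    have "(z \<otimes> a) [^] p = z [^] p \<otimes> a [^] p"
      using pow_mult_distrib[of z a p] D_central[of z a] that a by simp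
    then show ?thesis
      using D_pow_p[OF that] a by (simp add: N.norm_def N.partial_norm_def)
  qed
  have "N.norm x = \<one>" if x: "x \<in> B" for x
  proof -
    obtain i z where iz: "x = c [^] (i::int) \<otimes> z" "z \<in> D"
      using x by (auto simp: B_def)
    have "N.norm x = N.norm (c [^] i) \<otimes> N.norm z"
      using N.norm.hom_mult[of "c [^] i" z] iz c_B D_B by simp
    also have "N.norm (c [^] i) = N.norm c [^]\<^bsub>N.AG\<^esub> i"
      using N.norm.hom_int_pow[of c i] c_B N.AG_int_pow[of c i] by simp
    finally show ?thesis
      using norm_c norm_D[OF iz(2)] N.AG.int_pow_one[of i] by simp
  qed
  then have "N.C \<subseteq> {\<one>}"
    by (auto simp: N.C_def)
  moreover have "\<not> N.D \<subseteq> {\<one>}"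
  proof
    assume "N.D \<subseteq> {\<one>}"
    moreover have "a \<otimes> c \<otimes> inv a \<otimes> inv c \<in> N.D"
      using c_B a unfolding N.D_def N.conj_def by (intro image_eqI[of _ _ c]) simp_all
    ultimately have "a \<otimes> c \<otimes> inv a \<otimes> inv c = \<one>"
      by blast
    then have "a \<otimes> c \<otimes> inv a = c"
      using a c by (metis inv_closed inv_equality inv_inv m_closed A.mem_carrier)
    then have "c \<otimes> a = a \<otimes> c"
      using a c by (metis A.mem_carrier inv_solve_right m_closed)
    then show False
      using a_noncentral central_of_commutes_notin[OF c(1,2) a] by blast
  qed
  ultimately have "\<not> N.D \<subseteq> N.C"
    by blast
  then show ?thesis
    by (rule N.order_dvd_of_not_D_subset_C)
qed

end

proposition (in cyclic_extension) order_dvd_order_AutoGroup: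
  assumes "\<not> cyclic_group G" "order G \<ge> p ^ 3"
  shows "order G dvd order (AutoGroup G)"
proof (cases "D \<subseteq> C \<and> (\<exists>a\<in>A. A = {a [^] (i::int) \<otimes> d | i d. d \<in> D})")
  case False
  then show ?thesis
    using order_dvd_of_not_D_subset_C order_dvd_of_noncyclic by blast
next
  case True
  then obtain a where "a \<in> A" "A = {a [^] (i::int) \<otimes> d | i d. d \<in> D}" "D \<subseteq> C" by blast
  then interpret cyclic_quotient G A g p n a
    using assms(1) by unfold_locales
  show ?thesis
    using order_dvd_of_pow_notin_D order_dvd_of_pow_in_D assms(2) by blast
qed

section \<open>Maximal subgroups of \<open>p\<close>-groups\<close>

text \<open>Orbit sizes are powers of \<open>p\<close>. With \<open>x0\<close> as the only fixed
  point, \<open>card E\<close> would be \<open>1\<close> modulo \<open>p\<close>.\<close>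

lemma (in group_action) exists_second_fixed_point:
  assumes p: "Factorial_Ring.prime p" and ord: "order G = p ^ m" and fin: "finite E" and "p dvd card E"
    and x0: "x0 \<in> E" "\<And>g. g \<in> carrier G \<Longrightarrow> \<phi> g x0 = x0"
  shows "\<exists>x\<in>E. x \<noteq> x0 \<and> (\<forall>g\<in>carrier G. \<phi> g x = x)"
proof (rule ccontr)
  assume no_fixed: "\<not> ?thesis"
  have orb: "p dvd card (orbit G \<phi> x)" if x: "x \<in> E" "x \<noteq> x0" for x
  proof -
    have "card (orbit G \<phi> x) dvd p ^ m"
      using orbit_stabilizer_theorem[OF x(1)] ord by (metis dvd_triv_left)
    then obtain k where k: "card (orbit G \<phi> x) = p ^ k"
      using divides_primepow_nat[OF p] by blast
    have "k \<noteq> 0"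
    proof
      assume "k = 0"
      then obtain y where y: "orbit G \<phi> x = {y}"
        using k by (auto simp: card_1_singleton_iff)
      have "\<phi> g x = x" if "g \<in> carrier G" for g
      proof -
        have "\<phi> g x \<in> orbit G \<phi> x"
          using that by (auto simp: orbit_def)
        then show ?thesis
          using y orbit_refl[OF x(1)] by simp
      qed
      then show False
        using no_fixed x by blast
    qed
    then show ?thesis
      using k by simp
  qed
  have orbits: "finite (orbits G E \<phi>)"
    using fin by (auto simp: orbits_def)
  have orbit_x0: "orbit G \<phi> x0 = {x0}"
    using x0(2) orbit_refl[OF x0(1)] by (auto simp: orbit_def)
  have "card E = (\<Sum>orb\<in>orbits G E \<phi>. card orb)"
    using disjoint_sum[OF fin, of "\<lambda>_. 1::nat"] by simp
  also have "\<dots> = card {x0} + (\<Sum>orb\<in>orbits G E \<phi> - {{x0}}. card orb)"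
    by (rule sum.remove[OF orbits]) (use orbit_x0 x0(1) in \<open>auto simp: orbits_def\<close>)
  finally have "card E = 1 + (\<Sum>orb\<in>orbits G E \<phi> - {{x0}}. card orb)"
    by simp
  moreover have "p dvd (\<Sum>orb\<in>orbits G E \<phi> - {{x0}}. card orb)"
  proof (rule dvd_sum)
    fix B assume "B \<in> orbits G E \<phi> - {{x0}}"
    then obtain x where "x \<in> E" "B = orbit G \<phi> x" "B \<noteq> {x0}"
      by (auto simp: orbits_def)
    then show "p dvd card B"
      using orb[of x] orbit_x0 by auto
  qed
  ultimately have "p dvd 1"
    using \<open>p dvd card E\<close> by (metis dvd_add_left_iff)
  then show False
    using p by simp
qed

text \<open>The inverse turns right multiplication into a left action. A coset \<open>A #> y\<close>
  is fixed by all of \<open>A\<close> exactly when \<open>y\<close> conjugates \<open>A\<close> into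
  itself.\<close>

lemma (in group) rcosets_action:
  assumes A: "subgroup A G"
  shows "group_action (G\<lparr>carrier := A\<rparr>) (rcosets A) (\<lambda>a. \<lambda>R\<in>rcosets A. R #> inv a)"
proof -
  interpret A: subgroup A G by (rule A)
  have R: "R \<subseteq> carrier G" if "R \<in> rcosets A" for R
    using A.rcosets_carrier[OF is_group that] .
  have act: "R #> x #> y = R #> (x \<otimes> y)"
    if "R \<in> rcosets A" "x \<in> carrier G" "y \<in> carrier G" for R x y
    using R that by (simp add: coset_mult_assoc)
  have one: "R #> \<one> = R" if "R \<in> rcosets A" for R
    using R[OF that] by simp
  have closed: "R #> x \<in> rcosets A" if RA: "R \<in> rcosets A" and x: "x \<in> carrier G" for R x
  proof -
    obtain r where r: "r \<in> carrier G" "R = A #> r"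
      using RA by (auto simp: RCOSETS_def)
    then show ?thesis
      using x A.subset by (auto simp: coset_mult_assoc intro!: rcosetsI)
  qed
  let ?\<phi> = "\<lambda>a. \<lambda>R\<in>rcosets A. R #> inv a"
  have Bij: "?\<phi> a \<in> Bij (rcosets A)" if a: "a \<in> A" for a
  proof -
    have "bij_betw (?\<phi> a) (rcosets A) (rcosets A)"
      by (rule bij_betw_byWitness[where f' = "\<lambda>R. R #> a"]) (use a closed act one in auto)
    then show ?thesis by (simp add: Bij_def)
  qed
  have "?\<phi> \<in> hom (G\<lparr>carrier := A\<rparr>) (BijGroup (rcosets A))"
  proof (rule homI)
    fix a b assume ab: "a \<in> carrier (G\<lparr>carrier := A\<rparr>)" "b \<in> carrier (G\<lparr>carrier := A\<rparr>)"
    have "?\<phi> (a \<otimes> b) = compose (rcosets A) (?\<phi> a) (?\<phi> b)"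
      by (rule extensionalityI[of _ "rcosets A"])
        (use ab closed act in \<open>auto simp: compose_def inv_mult_group\<close>)
    then show "?\<phi> (a \<otimes>\<^bsub>G\<lparr>carrier := A\<rparr>\<^esub> b) = ?\<phi> a \<otimes>\<^bsub>BijGroup (rcosets A)\<^esub> ?\<phi> b"
      using ab Bij by (simp add: BijGroup_def)
  qed (use Bij in \<open>simp add: BijGroup_def\<close>)
  then show ?thesis
    unfolding group_action_def group_hom_def group_hom_axioms_def
    using subgroup_imp_group[OF A] group_BijGroup by blast
qed

text \<open>Normalizers grow in \<open>p\<close>-groups: the normalizer \<open>N\<close> of
  \<open>A\<close> is strictly larger than \<open>A\<close>, so maximality makes it the whole
  group.\<close>

lemma (in group) maximal_subgroup_normalized:
  assumes p: "Factorial_Ring.prime p" and fin: "finite (carrier G)" and ord: "order G = p ^ n"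
    and max: "maximal_subgroup A G" and x: "x \<in> carrier G" and a: "a \<in> A"
  shows "x \<otimes> a \<otimes> inv x \<in> A"
proof -
  have A: "subgroup A G" "A \<noteq> carrier G"
    and A_max: "\<And>H. subgroup H G \<Longrightarrow> A \<subseteq> H \<Longrightarrow> H = A \<or> H = carrier G"
    using max by (auto simp: maximal_subgroup_def)
  interpret A: subgroup A G by (rule A)
  define N where "N = {x \<in> carrier G. \<forall>a\<in>A. x \<otimes> a \<otimes> inv x \<in> A}"
  have "subgroup N G"
  proof (rule finite_mult_closed_subgroup[OF fin])
    show "N \<noteq> {}"
      unfolding N_def by (auto intro!: exI[of _ \<one>])
    fix x y assume xy: "x \<in> N" "y \<in> N"
    have "x \<otimes> y \<otimes> a \<otimes> inv (x \<otimes> y) \<in> A" if "a \<in> A" for a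
    proof -
      have "x \<otimes> (y \<otimes> a \<otimes> inv y) \<otimes> inv x \<in> A"
        using xy that unfolding N_def by blast
      then show ?thesis
        using xy that by (simp add: N_def group_normalize)
    qed
    then show "x \<otimes> y \<in> N"
      using xy by (simp add: N_def)
  qed (auto simp: N_def)
  moreover have "A \<subseteq> N"
    by (auto simp: N_def)
  moreover have "\<exists>y\<in>N. y \<notin> A"
  proof -
    interpret group_action "G\<lparr>carrier := A\<rparr>" "rcosets A" "\<lambda>a. \<lambda>R\<in>rcosets A. R #> inv a"
      by (rule rcosets_action[OF A(1)])
    have index: "card (rcosets A) * card A = p ^ n"
      using lagrange[OF A(1)] ord by simp
    then obtain k where k: "card (rcosets A) = p ^ k"
      using divides_primepow_nat[OF p] by (metis dvd_triv_left)
    obtain m where m: "card A = p ^ m"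
      using card_subgroup_prime_power[OF p ord A(1)] by blast
    have "k \<noteq> 0"
    proof
      assume "k = 0"
      then have "card A = card (carrier G)"
        using index k ord by (simp add: order_def)
      then show False
        using A(2) fin A.subset card_subset_eq by blast
    qed
    moreover have "A \<in> rcosets A"
      using A.subgroup_in_rcosets[OF is_group] .
    moreover have "A #> inv a = A" if "a \<in> A" for a
      using that A(1) by (intro coset_join2) auto
    moreover have "finite (rcosets A)"
      using k prime_gt_0_nat[OF p] by (metis card_ge_0_finite zero_less_power)
    \<comment> \<open>The index is a multiple of \<open>p\<close> and \<open>A\<close> is itself a
      fixed coset, so there is another one; its representatives lie in \<open>N\<close> but outside
      \<open>A\<close>.\<close>
    ultimately obtain R where R: "R \<in> rcosets A" "R \<noteq> A" "\<forall>a\<in>A. R #> inv a = R"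
      using exists_second_fixed_point[of p m A] p m k by (auto simp: order_def)
    obtain y where y: "y \<in> carrier G" "R = A #> y"
      using R(1) by (auto simp: RCOSETS_def)
    have "y \<notin> A"
      using y R(2) A(1) coset_join2 by blast
    moreover have "y \<otimes> a \<otimes> inv y \<in> A" if a: "a \<in> A" for a
    proof -
      have "A #> y #> inv (inv a) = A #> y"
        using R(3) a y by blast
      then have "A #> (y \<otimes> a) = A #> y"
        using a y A.subset by (simp add: coset_mult_assoc)
      then have "y \<otimes> a \<in> A #> y"
        using rcos_self[of "y \<otimes> a" A] a y A(1) by simp
      then obtain a' where "a' \<in> A" "y \<otimes> a = a' \<otimes> y"
        by (auto simp: r_coset_def)
      then show ?thesis
        using a y by (simp add: m_assoc)
    qed
    ultimately show ?thesis
      using y by (auto simp: N_def)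
  qed
  ultimately have "N = carrier G"
    using A_max by blast
  then show ?thesis
    using x a by (auto simp: N_def)
qed

text \<open>For \<open>g\<close> one takes the last iterated \<open>p\<close>-th power of some
  outside element that is still outside \<open>A\<close>. As \<open>A\<close> is normalized by
  \<open>g\<close>, the products \<open>a \<otimes> g [^] i\<close> form a subgroup, which is all of
  \<open>G\<close> by maximality.\<close>

lemma (in group) maximal_subgroup_cyclic_extension:
  assumes p: "Factorial_Ring.prime p" and fin: "finite (carrier G)" and ord: "order G = p ^ n"
    and max: "maximal_subgroup A G" and comm: "comm_group (G\<lparr>carrier := A\<rparr>)"
  shows "\<exists>g. cyclic_extension G A g p n"
proof -
  have A: "subgroup A G" "A \<noteq> carrier G"
    and A_max: "\<And>H. subgroup H G \<Longrightarrow> A \<subseteq> H \<Longrightarrow> H = A \<or> H = carrier G"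
    using max by (auto simp: maximal_subgroup_def)
  interpret A: subgroup A G by (rule A)
  note normal = maximal_subgroup_normalized[OF p fin ord max]
  obtain x where x: "x \<in> carrier G" "x \<notin> A"
    using A A.subset by blast
  have "x [^] (p ^ n) \<in> A"
    using pow_order_eq_1[OF x(1)] ord by simp
  then obtain k where k: "x [^] (p ^ k) \<notin> A" "(x [^] (p ^ k)) [^] p \<in> A"
    using exists_last_power_notin[OF x] by blast
  define g where "g = x [^] (p ^ k)"
  have g: "g \<in> carrier G" "g \<notin> A" "g [^] p \<in> A"
    using k x by (auto simp: g_def)
  define B where "B = {a \<otimes> g [^] (i::nat) | a i. a \<in> A}"
  have "subgroup B G"
  proof (rule finite_mult_closed_subgroup[OF fin])
    show "B \<subseteq> carrier G"
      using g by (auto simp: B_def)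
    show "B \<noteq> {}"
      using A.one_closed unfolding B_def by blast
    fix u v assume "u \<in> B" "v \<in> B"
    then obtain a i b j where uv: "u = a \<otimes> g [^] (i::nat)" "a \<in> A" "v = b \<otimes> g [^] (j::nat)" "b \<in> A"
      by (auto simp: B_def)
    have "u \<otimes> v = (a \<otimes> (g [^] i \<otimes> b \<otimes> inv (g [^] i))) \<otimes> g [^] (i + j)"
      using uv g by (simp add: group_normalize flip: nat_pow_mult)
    moreover have "a \<otimes> (g [^] i \<otimes> b \<otimes> inv (g [^] i)) \<in> A"
      using normal[of "g [^] i" b] uv g by simp
    ultimately show "u \<otimes> v \<in> B"
      unfolding B_def by blast
  qed
  moreover have "a \<otimes> g [^] (0::nat) \<in> B" "\<one> \<otimes> g [^] (1::nat) \<in> B" if "a \<in> A" for a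
    using that A.one_closed unfolding B_def by blast+
  then have "A \<subseteq> B" "g \<in> B"
    using g A.one_closed by auto
  ultimately have B: "B = carrier G"
    using A_max g(2) by blast
  have "cyclic_extension G A g p n"
  proof (intro cyclic_extension.intro cyclic_extension_axioms.intro)
    show "x \<otimes> y = y \<otimes> x" if "x \<in> A" "y \<in> A" for x y
      using comm_groupE(4)[OF comm] that by simp
    show "\<exists>a\<in>A. \<exists>i::nat. x = a \<otimes> g [^] i" if "x \<in> carrier G" for x
      using that unfolding B[symmetric] by (auto simp: B_def)
  qed (use p fin ord A g normal is_group in auto)
  then show ?thesis by blast
qed

theorem theorem2p4:
  fixes G :: "('a, 'b) monoid_scheme" and A :: "'a set" and p :: nat
  assumes "Factorial_Ring.prime p"
    and "finite_p_group p G"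
    and "\<not> cyclic_group G"
    and "order G \<ge> p ^ 3"
    and "maximal_subgroup A G"
    and "comm_group (G\<lparr>carrier := A\<rparr>)"
  shows "order G dvd order (AutoGroup G)"
proof -
  obtain n where G: "group G" "finite (carrier G)" "order G = p ^ n"
    using assms(2) by (auto simp: finite_p_group_def)
  then obtain g where "cyclic_extension G A g p n"
    using group.maximal_subgroup_cyclic_extension[OF G(1) assms(1) G(2,3) assms(5,6)] by blast
  then show ?thesis
    by (rule cyclic_extension.order_dvd_order_AutoGroup) (fact assms)+
qed

end
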